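(* Let $d\ge1$ and $m \geq 1$ be integers, let $\Lambda(m)=\{x\in\mathbb{Z}^d : m\nmid x_i \text{ for all } 1\le i\le d\}$, and let $\sigma = \overline{2d-2}+1_{\Lambda(m)}$ (i.e. $\sigma(x)=2d-1$ if $x\in\Lambda(m)$ and $\sigma(x)=2d-2$ otherwise). Then $\sigma$ is robust on $\mathbb{Z}^d$. Moreover, writing $T_{n}$ for the set of sites in $\mathbb{Z}^d$ that topple during the stabilization of $\sigma+n\delta_o$, for any $\epsilon>0$ we have $T_{n}\subset Q_r$ for all sufficiently large $n$, where \[ r = m(d+\epsilon)\left(\frac{n}{\omega_d}\right)^{1/d}. \]
   Context: Abelian sandpile on $\mathbb{Z}^d$: a configuration is a function $\eta:\mathbb{Z}^d\to\mathbb{Z}$. A site $x$ is unstable if $\eta(x)\ge 2d$; toppling $x$ sends one particle from $x$ to each of its $2d$ lattice neighbours. A configuration is stable if $\eta\le 2d-1$ everywhere. $\overline{h}$ is the constant configuration equal to $h$, $1_A$ the indicator of $A$, $\delta_o$ a single particle at the origin. Given a stable background $\sigma$ and $n\ge1$, enumerate the sites of $\mathbb{Z}^d$ (say by increasing distance from the origin) and topple, at each discrete time step, the smallest unstable site of $\sigma+n\delta_o$ (if any); $T_n$ is the set of sites that ever topple. $\sigma$ is called robust if $T_n$ is finite for every $n\ge1$ (then $\sigma+n\delta_o$ stabilizes and $T_n$ is the set of sites toppling in its stabilization, independent of the legal toppling order). $Q_r=\{x\in\mathbb{Z}^d:\max_i|x_i|\le r\}$; $\omega_d$ is the volume of the unit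 ball in $\mathbb{R}^d$. *)

theory Defs
  imports "HOL-Analysis.Analysis"
begin

text \<open>The lattice is \<open>int ^ 'd\<close>, with dimension \<open>d = CARD('d)\<close>.\<close>

type_synonym 'd config = "(int, 'd) vec \<Rightarrow> int"

definition unstable :: "'d::finite config \<Rightarrow> int ^ 'd \<Rightarrow> bool" where
  "unstable \<eta> x \<longleftrightarrow> \<eta> x \<ge> 2 * int CARD('d)"

definition stable :: "'d::finite config \<Rightarrow> bool" where
  "stable \<eta> \<longleftrightarrow> (\<forall>x. \<eta> x \<le> 2 * int CARD('d) - 1)"

definition neighbours :: "int ^ 'd \<Rightarrow> (int ^ 'd::finite) set" where
  "neighbours x = {y. (\<Sum>i\<in>UNIV. \<bar>x $ i - y $ i\<bar>) = 1}"

definition topple :: "int ^ 'd \<Rightarrow> 'd::finite config \<Rightarrow> 'd config" where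
  "topple x \<eta> = (\<lambda>y. \<eta> y - 2 * int CARD('d) * indicator {x} y + indicator (neighbours x) y)"

text \<open>
  The parameter \<open>e\<close> is an enumeration of the lattice; \<open>next_site e \<eta>\<close> is
  meaningful only if \<open>\<eta>\<close> has an unstable site.
\<close>

definition next_site :: "(nat \<Rightarrow> int ^ 'd) \<Rightarrow> 'd::finite config \<Rightarrow> int ^ 'd" where
  "next_site e \<eta> = e (LEAST k. unstable \<eta> (e k))"

definition step :: "(nat \<Rightarrow> int ^ 'd) \<Rightarrow> 'd::finite config \<Rightarrow> 'd config" where
  "step e \<eta> = (if \<exists>x. unstable \<eta> x then topple (next_site e \<eta>) \<eta> else \<eta>)"

definition config_at :: "(nat \<Rightarrow> int ^ 'd) \<Rightarrow> 'd::finite config \<Rightarrow> nat \<Rightarrow> 'd config" where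
  "config_at e \<eta> t = (step e ^^ t) \<eta>"

definition add_origin :: "'d::finite config \<Rightarrow> nat \<Rightarrow> 'd config" where
  "add_origin \<sigma> n = (\<lambda>x. \<sigma> x + int n * indicator {0} x)"

definition toppled_sites :: "(nat \<Rightarrow> int ^ 'd) \<Rightarrow> 'd::finite config \<Rightarrow> nat \<Rightarrow> (int ^ 'd) set" where
  "toppled_sites e \<sigma> n =
     {next_site e (config_at e (add_origin \<sigma> n) t) | t.
        \<exists>x. unstable (config_at e (add_origin \<sigma> n) t) x}"

definition robust :: "(nat \<Rightarrow> int ^ 'd) \<Rightarrow> 'd::finite config \<Rightarrow> bool" where
  "robust e \<sigma> \<longleftrightarrow> stable \<sigma> \<and> (\<forall>n\<ge>1. finite (toppled_sites e \<sigma> n))"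

definition cube :: "real \<Rightarrow> (int ^ 'd::finite) set" where
  "cube r = {x. real_of_int (Max (range (\<lambda>i. \<bar>x $ i\<bar>))) \<le> r}"

definition Lam :: "nat \<Rightarrow> (int ^ 'd::finite) set" where
  "Lam m = {x. \<forall>i. \<not> int m dvd x $ i}"

definition background :: "nat \<Rightarrow> 'd::finite config" where
  "background m = (\<lambda>x. 2 * int CARD('d) - 2 + indicator (Lam m) x)"

end

theory Submission
  imports Defs "HOL-Real_Asymp.Real_Asymp"
begin

text \<open>
  By the least action principle, every \<open>w \<ge> 0\<close> such that \<open>\<sigma> + n \<delta>\<^sub>o + \<Delta> w\<close> is
  stable bounds the odometer, so the sites that topple lie in the support of \<open>w\<close>. We take
  \<open>w = w\<^sub>1 + w\<^sub>2\<close>.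

  Here \<open>w\<^sub>1\<close> is a minimal nonnegative integer function with \<open>\<Delta> w\<^sub>1 \<le> d - n \<delta>\<^sub>o\<close>.
  By minimality, a burning argument bounds the total height of the configuration
  \<open>d - 1 + n \<delta>\<^sub>o + \<Delta> w\<^sub>1\<close> on a set of toppled sites from below by the number of its inner
  edges, so the average height on large boxes is at least \<open>d - o(1)\<close>, and smoothing turns \<open>w\<^sub>1\<close> into
  a function with Laplacian at least \<open>1 - o(1)\<close> off the source.
  Comparison with explicit radial functions yields that \<open>w\<^sub>1\<close> is bounded, independently of
  \<open>n\<close>, outside a ball of volume \<open>(1 + o(1)) n\<close>. Since the maximum of \<open>w\<^sub>1\<close> over
  a half-space decreases by at least 1 when the half-space is shifted by 1, the support of \<open>w\<^sub>1\<close>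
  lies in a cube whose radius \<open>R\<close> exceeds that of the ball by a constant.

  The function \<open>w\<^sub>2\<close> is a combination of indicators of concentric cubes. Toppling all sites
  of a cube moves one particle across each boundary edge; an increasing number of topplings per cube
  removes the excess inside the cube of radius \<open>R\<close>, and a number that decreases by 1 every \<open>m\<close>
  shells deposits it outside. This ends at radius about \<open>m d R\<close>.
\<close>

section \<open>The least action principle\<close>

text \<open>Valued in an abelian group, to serve integer odometers and real comparison functions
  alike; no factor 2 is available there, hence the repeated \<open>f x\<close>.\<close>

definition lap :: "(int ^ 'd \<Rightarrow> 'a::ab_group_add) \<Rightarrow> int ^ 'd::finite \<Rightarrow> 'a" where
  "lap f x = (\<Sum>i\<in>UNIV. f (x + axis i 1) + f (x - axis i 1) - f x - f x)"

lemma lap_add: "lap (\<lambda>x. f x + g x) x = lap f x + lap g x"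
  unfolding lap_def sum.distrib[symmetric] by (intro sum.cong refl) (simp add: algebra_simps)

lemma lap_diff: "lap (\<lambda>x. f x - g x) x = lap f x - lap g x"
  unfolding lap_def sum_subtractf[symmetric] by (intro sum.cong refl) (simp add: algebra_simps)

lemma lap_sum: "lap (\<lambda>x. \<Sum>k\<in>S. f k x) x = (\<Sum>k\<in>S. lap (f k) x)"
proof -
  have "(\<Sum>k\<in>S. lap (f k) x) =
      (\<Sum>i\<in>UNIV. \<Sum>k\<in>S. f k (x + axis i 1) + f k (x - axis i 1) - f k x - f k x)"
    unfolding lap_def by (rule sum.swap)
  then show ?thesis
    by (simp add: lap_def sum.distrib sum_subtractf)
qed

lemma lap_mult: "lap (\<lambda>x. c * f x) x = c * lap f x" for c :: "'a::ring"
  by (simp add: lap_def sum_distrib_left algebra_simps)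

lemma lap_const: "lap (\<lambda>x. c) x = 0"
  by (simp add: lap_def)

lemma lap_shift: "lap (\<lambda>x. f (x + z)) x = lap f (x + z)"
  by (simp add: lap_def algebra_simps)

lemma lap_of_int: "lap (\<lambda>x. real_of_int (f x)) = (\<lambda>x. real_of_int (lap f x))"
  by (simp add: lap_def fun_eq_iff)

text \<open>A discrete maximum principle: only the value at \<open>x\<close> enters with a negative
  sign, and there the two functions agree.\<close>

lemma lap_mono_touching:
  fixes f g :: "int ^ 'd::finite \<Rightarrow> 'a::ordered_ab_group_add"
  assumes "\<And>y. f y \<le> g y" "f x = g x"
  shows "lap f x \<le> lap g x"
  unfolding lap_def using assms by (intro sum_mono) (simp add: add_mono)

lemma lap_eq: "lap f x = (\<Sum>i\<in>UNIV. f (x + axis i 1) + f (x - axis i 1)) - 2 * int CARD('d) * f x"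
  for f :: "int ^ 'd::finite \<Rightarrow> int"
  by (simp add: lap_def sum_subtractf)

text \<open>Lets a coordinate line be traversed along a chosen sign \<open>s\<close>, such as the
  outward direction of a cube or of a half-space.\<close>

lemma sum_opposite:
  fixes f :: "int ^ 'd::finite \<Rightarrow> int"
  assumes "\<bar>s\<bar> = (1::int)"
  shows "f (x + axis i 1) + f (x - axis i 1) = f (x + axis i s) + f (x + axis i (- s))"
proof -
  have "axis i (-1) = - axis i (1::int)"
    by (simp add: vec_eq_iff axis_def)
  moreover have "s = 1 \<or> s = -1"
    using assms by auto
  ultimately show ?thesis
    by auto
qed

lemma neighbours_iff:
  "y \<in> neighbours x \<longleftrightarrow> (\<exists>i. x = y + axis i 1 \<or> x = y - axis i 1)" for x y :: "int ^ 'd::finite"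
proof
  assume "y \<in> neighbours x"
  then have s: "(\<Sum>i\<in>UNIV. \<bar>x $ i - y $ i\<bar>) = 1"
    by (simp add: neighbours_def)
  then obtain i where i: "x $ i - y $ i \<noteq> 0"
    by (metis (no_types, lifting) abs_zero sum.neutral zero_neq_one)
  have eq: "(\<Sum>i\<in>UNIV. \<bar>x $ i - y $ i\<bar>) = \<bar>x $ i - y $ i\<bar> + (\<Sum>j\<in>UNIV - {i}. \<bar>x $ j - y $ j\<bar>)"
    by (simp add: sum.remove)
  have ge: "(\<Sum>j\<in>UNIV - {i}. \<bar>x $ j - y $ j\<bar>) \<ge> 0"
    by (simp add: sum_nonneg)
  have z: "(\<Sum>j\<in>UNIV - {i}. \<bar>x $ j - y $ j\<bar>) = 0" and i1: "\<bar>x $ i - y $ i\<bar> = 1"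
    using s eq ge i by linarith+
  have "x $ j = y $ j" if "j \<noteq> i" for j
    using z that by (simp add: sum_nonneg_eq_0_iff)
  then have "x = y + axis i 1 \<or> x = y - axis i 1"
    using i1 by (auto simp: vec_eq_iff axis_def abs_if split: if_splits)
  then show "\<exists>i. x = y + axis i 1 \<or> x = y - axis i 1" ..
next
  assume "\<exists>i. x = y + axis i 1 \<or> x = y - axis i 1"
  then obtain i where "x = y + axis i 1 \<or> x = y - axis i 1" ..
  then have "\<bar>x $ j - y $ j\<bar> = (if j = i then 1 else 0)" for j
    by (auto simp: axis_def)
  then show "y \<in> neighbours x"
    by (simp add: neighbours_def)
qed

lemma axis_add_neq_diff: "y + axis i (1::int) \<noteq> y - axis j 1"
proof
  assume "y + axis i (1::int) = y - axis j 1"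
  then have "(y + axis i 1) $ i = (y - axis j 1) $ i"
    by simp
  then show False
    by (simp add: axis_def split: if_splits)
qed

lemma topple_eq_lap: "topple x \<eta> = (\<lambda>y. \<eta> y + lap (indicator {x}) y)" for x :: "int ^ 'd::finite"
proof
  fix y :: "int ^ 'd"
  have "(\<Sum>i\<in>UNIV. indicator {x} (y + axis i 1) + indicator {x} (y - axis i 1))
      = (indicator (neighbours x) y :: int)" (is "(\<Sum>i\<in>UNIV. ?f i) = _")
  proof (cases "y \<in> neighbours x")
    case True
    then obtain i where i: "x = y + axis i 1 \<or> x = y - axis i 1"
      by (auto simp: neighbours_iff)
    \<comment> \<open>Of the \<open>2 d\<close> indicators only one is nonzero, since distinct
      directions reach distinct neighbours.\<close>
    have "?f j = (if j = i then 1 else 0)" for j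
      using i
      by (auto simp: indicator_def axis_add_neq_diff axis_add_neq_diff[symmetric] axis_eq_axis)
    then show ?thesis
      using True by simp
  next
    case False
    then show ?thesis
      by (intro trans[OF sum.neutral]) (auto simp: neighbours_iff indicator_def)
  qed
  then show "topple x \<eta> y = \<eta> y + lap (indicator {x}) y"
    by (simp add: topple_def lap_eq)
qed

lemma unstable_next_site:
  assumes "bij e" "\<exists>x. unstable \<eta> x"
  shows "unstable \<eta> (next_site e \<eta>)"
proof -
  from assms obtain k where "unstable \<eta> (e k)"
    by (metis bij_pointE)
  then show ?thesis
    unfolding next_site_def by (rule LeastI)
qed

text \<open>The least action principle: the odometer \<open>u\<close> cannot overtake \<open>w\<close>, since
  a site where the two agree is stable.\<close>

lemma least_action_step:
  fixes e :: "nat \<Rightarrow> int ^ 'd::finite"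
  assumes e: "bij e" and w: "\<And>x. \<eta> x + lap w x \<le> 2 * int CARD('d) - 1"
    and u: "\<And>x. u x \<le> w x" and c: "c = (\<lambda>x. \<eta> x + lap u x)" and ex: "\<exists>x. unstable c x"
  shows "u (next_site e c) < w (next_site e c)"
proof (rule ccontr)
  assume "\<not> u (next_site e c) < w (next_site e c)"
  then have "u (next_site e c) = w (next_site e c)"
    using u[of "next_site e c"] by simp
  then have "lap u (next_site e c) \<le> lap w (next_site e c)"
    using u by (intro lap_mono_touching)
  moreover have "c (next_site e c) \<ge> 2 * int CARD('d)"
    using unstable_next_site[OF e ex] by (simp add: unstable_def)
  ultimately show False
    using w[of "next_site e c"] c by simp
qed

text \<open>Induction on time: the next site to topple satisfies \<open>u < w\<close> strictly, so
  raising \<open>u\<close> there by one keeps it below \<open>w\<close>.\<close>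

lemma config_at_odometer:
  fixes e :: "nat \<Rightarrow> int ^ 'd::finite"
  assumes e: "bij e" and w: "\<And>x. \<eta> x + lap w x \<le> 2 * int CARD('d) - 1"
    and w0: "\<And>x. 0 \<le> w x"
  shows "\<exists>u. (\<forall>x. 0 \<le> u x \<and> u x \<le> w x) \<and> config_at e \<eta> t = (\<lambda>x. \<eta> x + lap u x)"
proof (induction t)
  case 0
  show ?case
    using w0 by (intro exI[of _ "\<lambda>x. 0"]) (simp add: config_at_def lap_const)
next
  case (Suc t)
  then obtain u where u: "\<And>x. 0 \<le> u x" "\<And>x. u x \<le> w x"
    and c: "config_at e \<eta> t = (\<lambda>x. \<eta> x + lap u x)"
    by blast
  let ?c = "config_at e \<eta> t"
  have Suc_eq: "config_at e \<eta> (Suc t) = step e ?c"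
    by (simp add: config_at_def)
  show ?case
  proof (cases "\<exists>x. unstable ?c x")
    case False
    then show ?thesis
      using u c Suc_eq by (intro exI[of _ u]) (simp add: step_def)
  next
    case True
    define s where "s = next_site e ?c"
    have s: "u s < w s"
      unfolding s_def using least_action_step[OF e w u(2) c True] .
    have "config_at e \<eta> (Suc t) = topple s ?c"
      using True by (simp add: Suc_eq step_def s_def)
    then have "config_at e \<eta> (Suc t) = (\<lambda>x. \<eta> x + lap (\<lambda>y. u y + indicator {s} y) x)"
      by (simp add: topple_eq_lap lap_add c add.assoc)
    moreover have "0 \<le> u x + indicator {s} x \<and> u x + indicator {s} x \<le> w x" for x
      using u(1)[of x] u(2)[of x] s by (auto simp: indicator_def)
    ultimately show ?thesis
      by (intro exI[of _ "\<lambda>y. u y + indicator {s} y"]) simp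
  qed
qed

lemma toppled_sites_subset:
  fixes e :: "nat \<Rightarrow> int ^ 'd::finite"
  assumes e: "bij e" and w: "\<And>x. add_origin \<sigma> n x + lap w x \<le> 2 * int CARD('d) - 1"
    and w0: "\<And>x. 0 \<le> w x"
  shows "toppled_sites e \<sigma> n \<subseteq> {x. w x > 0}"
proof
  fix x assume "x \<in> toppled_sites e \<sigma> n"
  then obtain t where t: "x = next_site e (config_at e (add_origin \<sigma> n) t)"
    "\<exists>x. unstable (config_at e (add_origin \<sigma> n) t) x"
    by (auto simp: toppled_sites_def)
  obtain u where u: "\<And>x. 0 \<le> u x" "\<And>x. u x \<le> w x"
    and c: "config_at e (add_origin \<sigma> n) t = (\<lambda>x. add_origin \<sigma> n x + lap u x)"
    using config_at_odometer[OF e w w0] by blast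
  have "u x < w x"
    unfolding t(1) using least_action_step[OF e w u(2) c t(2)] .
  then show "x \<in> {x. w x > 0}"
    using u(1)[of x] by simp
qed

section \<open>Toppling cubes\<close>

definition linf :: "int ^ 'd::finite \<Rightarrow> nat" where
  "linf x = nat (Max (range (\<lambda>i. \<bar>x $ i\<bar>)))"

lemma Max_abs_nonneg: "Max (range (\<lambda>i. \<bar>x $ i\<bar>)) \<ge> 0" for x :: "int ^ 'd::finite"
  by (rule order_trans[OF abs_ge_zero Max_ge]) auto

lemma linf_le_iff: "linf x \<le> k \<longleftrightarrow> (\<forall>i. \<bar>x $ i\<bar> \<le> int k)"
  by (simp add: linf_def nat_le_iff)

lemma abs_le_linf: "\<bar>x $ i\<bar> \<le> int (linf x)"
  using linf_le_iff[of x "linf x"] by simp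

lemma linf_attained: obtains i where "\<bar>x $ i\<bar> = int (linf x)"
proof -
  have "Max (range (\<lambda>i. \<bar>x $ i\<bar>)) \<in> range (\<lambda>i. \<bar>x $ i\<bar>)"
    by (rule Max_in) auto
  then obtain i where "Max (range (\<lambda>i. \<bar>x $ i\<bar>)) = \<bar>x $ i\<bar>"
    by (rule imageE)
  then have "\<bar>x $ i\<bar> = int (linf x)"
    by (simp add: linf_def)
  then show ?thesis
    by (rule that)
qed

lemma linf_eqI:
  assumes "\<And>i. \<bar>x $ i\<bar> \<le> int k" "\<bar>x $ j\<bar> = int k"
  shows "linf x = k"
proof -
  have "linf x \<le> k"
    using assms(1) by (simp add: linf_le_iff)
  moreover have "int k \<le> int (linf x)"
    using assms(2) abs_le_linf[of x j] by simp
  ultimately show ?thesis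
    by simp
qed

lemma linf_0: "linf 0 = 0"
  by (rule linf_eqI) auto

lemma linf_eq_0_iff: "linf x = 0 \<longleftrightarrow> x = 0"
  using linf_le_iff[of x 0] by (auto simp: vec_eq_iff)

lemma mem_cube_iff: "x \<in> cube r \<longleftrightarrow> real (linf x) \<le> r"
  by (simp add: cube_def linf_def Max_abs_nonneg)

lemma finite_bounded_sites: "finite {x :: int ^ 'd::finite. \<forall>i. \<bar>x $ i\<bar> \<le> k}"
proof (rule finite_subset)
  show "{x :: int ^ 'd. \<forall>i. \<bar>x $ i\<bar> \<le> k} \<subseteq> vec_lambda ` (UNIV \<rightarrow>\<^sub>E {-k..k})"
  proof
    fix x :: "int ^ 'd"
    assume x: "x \<in> {x. \<forall>i. \<bar>x $ i\<bar> \<le> k}"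
    have "- k \<le> x $ i" "x $ i \<le> k" for i
      using x abs_le_iff[of "x $ i" k] by auto
    then have "vec_nth x \<in> UNIV \<rightarrow>\<^sub>E {-k..k}"
      by auto
    then show "x \<in> vec_lambda ` (UNIV \<rightarrow>\<^sub>E {-k..k})"
      by (metis image_eqI vec_nth_inverse)
  qed
  show "finite (vec_lambda ` (UNIV \<rightarrow>\<^sub>E {-k..k}) :: (int ^ 'd) set)"
    by (intro finite_imageI finite_PiE) auto
qed

lemma finite_linf_le: "finite {x :: int ^ 'd::finite. linf x \<le> k}"
  using finite_bounded_sites[of "int k"] by (simp add: linf_le_iff)

text \<open>The odometer of toppling all sites of the cube of radius \<open>j\<close> exactly
  \<open>a j\<close> times, for each \<open>j < r\<close>: the site \<open>x\<close> lies in the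
  cubes with \<open>j \<ge> linf x\<close>.\<close>

definition cubes :: "(nat \<Rightarrow> int) \<Rightarrow> nat \<Rightarrow> int ^ 'd::finite \<Rightarrow> int" where
  "cubes a r x = (\<Sum>j\<in>{linf x..<r}. a j)"

context
  fixes a :: "nat \<Rightarrow> int" and r :: nat
  assumes a0: "\<And>k. a k \<ge> 0" and ar: "\<And>k. k \<ge> r \<Longrightarrow> a k = 0"
begin

lemma cubes_nonneg: "cubes a r x \<ge> 0"
  unfolding cubes_def by (simp add: sum_nonneg a0)

lemma cubes_support: "linf x \<ge> r \<Longrightarrow> cubes a r x = 0"
  by (simp add: cubes_def)

lemma cubes_Suc:
  assumes "linf y = Suc (linf x)"
  shows "cubes a r y = cubes a r x - a (linf x)"
proof (cases "linf x < r")
  case True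
  then have "{linf x..<r} = insert (linf x) {Suc (linf x)..<r}"
    by auto
  then show ?thesis
    using assms by (simp add: cubes_def)
next
  case False
  then show ?thesis
    using assms ar by (simp add: cubes_def)
qed

lemma lap_cubes_0: "lap (cubes a r) (0 :: int ^ 'd::finite) = - 2 * int CARD('d) * a 0"
proof -
  have "linf (axis i (1::int)) = Suc (linf (0 :: int ^ 'd))"
    "linf (- axis i (1::int)) = Suc (linf (0 :: int ^ 'd))" for i :: 'd
    by (auto intro!: linf_eqI[of _ _ i] simp: linf_0 axis_def)
  note this[THEN cubes_Suc, unfolded linf_0]
  then show ?thesis
    by (simp add: lap_def)
qed

text \<open>Moving a coordinate that does not attain the sup norm leaves the norm unchanged, because
  another coordinate still attains it.\<close>

lemma cubes_inner_direction:
  assumes "\<bar>x $ i\<bar> < int (linf x)"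
  shows "cubes a r (x + axis i 1) = cubes a r x" "cubes a r (x - axis i 1) = cubes a r x"
proof -
  obtain j where j: "\<bar>x $ j\<bar> = int (linf x)"
    by (rule linf_attained)
  then have ji: "j \<noteq> i"
    using assms by auto
  have "linf (x + axis i 1) = linf x" "linf (x - axis i 1) = linf x"
    using assms abs_le_linf[of x] j ji by (auto intro!: linf_eqI[of _ _ j] simp: axis_def)
  then show "cubes a r (x + axis i 1) = cubes a r x" "cubes a r (x - axis i 1) = cubes a r x"
    by (simp_all add: cubes_def)
qed

lemma cubes_outward:
  assumes "\<bar>x $ i\<bar> = int (linf x)" "\<bar>s\<bar> = 1" "s * x $ i \<ge> 0"
  shows "cubes a r (x + axis i s) = cubes a r x - a (linf x)"
proof -
  have "\<bar>x $ i + s\<bar> = 1 + int (linf x)"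
    using assms by (auto simp: abs_if split: if_splits)
  moreover have "\<bar>x $ j\<bar> \<le> 1 + int (linf x)" for j
    using abs_le_linf[of x j] by simp
  ultimately have "linf (x + axis i s) = Suc (linf x)"
    by (auto intro!: linf_eqI[of _ _ i] simp: axis_def)
  then show ?thesis
    by (rule cubes_Suc)
qed

lemma cubes_inward_single:
  assumes "\<bar>x $ i\<bar> = int (linf x)" "\<And>j. j \<noteq> i \<Longrightarrow> \<bar>x $ j\<bar> < int (linf x)"
    and "\<bar>s\<bar> = 1" "s * x $ i < 0"
  shows "cubes a r (x + axis i s) = cubes a r x + a (linf x - 1)"
proof -
  have pos: "linf x \<ge> 1"
    using assms(1,4) by (cases "linf x") auto
  have "\<bar>x $ i + s\<bar> = int (linf x - 1)"
    using assms pos by (auto simp: abs_if split: if_splits)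
  moreover have "\<bar>x $ j\<bar> \<le> int (linf x - 1)" if "j \<noteq> i" for j
    using assms(2)[OF that] pos by simp
  ultimately have "linf (x + axis i s) = linf x - 1"
    by (intro linf_eqI[of _ _ i]) (auto simp: axis_def)
  then show ?thesis
    using cubes_Suc[of x "x + axis i s"] pos by simp
qed

lemma cubes_inward_multiple:
  assumes "\<bar>x $ i\<bar> = int (linf x)" "j \<noteq> i" "\<bar>x $ j\<bar> = int (linf x)"
    and "\<bar>s\<bar> = 1" "s * x $ i < 0"
  shows "cubes a r (x + axis i s) = cubes a r x"
proof -
  have "\<bar>x $ i + s\<bar> \<le> int (linf x)"
    using assms by (auto simp: abs_if split: if_splits)
  then have "linf (x + axis i s) = linf x"
    using assms abs_le_linf[of x] by (intro linf_eqI[of _ _ j]) (auto simp: axis_def)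
  then show ?thesis
    by (simp add: cubes_def)
qed

text \<open>If a single coordinate attains the norm, \<open>x\<close> has one outward and one inward
  neighbour, which gives the first entry. On edges and corners of the cube at least two coordinates
  attain it; no inward step lowers the norm then, and each such direction contributes
  \<open>- a (linf x)\<close>.\<close>

lemma lap_cubes_le:
  fixes x :: "int ^ 'd::finite"
  assumes "x \<noteq> 0"
  shows "lap (cubes a r) x \<le> max (a (linf x - 1) - a (linf x)) (- 2 * a (linf x))"
proof -
  let ?f = "cubes a r"
  let ?g = "\<lambda>i. ?f (x + axis i 1) + ?f (x - axis i 1) - ?f x - ?f x"
  have pos: "linf x \<ge> 1"
    using assms by (metis linf_eq_0_iff less_one not_less)
  obtain i where i: "\<bar>x $ i\<bar> = int (linf x)"
    by (rule linf_attained)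
  define s where "s j = (if x $ j \<ge> 0 then 1 else - 1 :: int)" for j
  have s: "\<bar>s j\<bar> = 1" "s j * x $ j \<ge> 0" "\<bar>- s j\<bar> = 1" for j
    by (auto simp: s_def)
  have s': "- s j * x $ j < 0" if "\<bar>x $ j\<bar> = int (linf x)" for j
    using that pos by (auto simp: s_def)
  have inner: "?g j = 0" if "\<bar>x $ j\<bar> < int (linf x)" for j
    using cubes_inner_direction[OF that] by simp
  show ?thesis
  proof (cases "\<exists>j. j \<noteq> i \<and> \<bar>x $ j\<bar> = int (linf x)")
    case False
    then have less: "\<bar>x $ j\<bar> < int (linf x)" if "j \<noteq> i" for j
      using that abs_le_linf[of x j] by (metis order_le_less)
    have "?g i = a (linf x - 1) - a (linf x)"
      using sum_opposite[OF s(1), of ?f x i i] cubes_outward[OF i s(1,2)]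
        cubes_inward_single[OF i less s(3) s'[OF i]]
      by simp
    moreover have "lap ?f x = ?g i + (\<Sum>j\<in>UNIV - {i}. ?g j)"
      unfolding lap_def by (rule sum.remove) auto
    ultimately show ?thesis
      using inner less by simp
  next
    case True
    then obtain j where j: "j \<noteq> i" "\<bar>x $ j\<bar> = int (linf x)"
      by blast
    have ext: "?g l = - a (linf x)" if l: "\<bar>x $ l\<bar> = int (linf x)" for l
    proof -
      obtain l' where "l' \<noteq> l" "\<bar>x $ l'\<bar> = int (linf x)"
        using i j by metis
      then show ?thesis
        using sum_opposite[OF s(1), of ?f x l l] cubes_outward[OF l s(1,2)]
          cubes_inward_multiple[OF l _ _ s(3) s'[OF l]]
        by simp
    qed
    have le: "?g l \<le> 0" for l
      using ext[of l] inner[of l] abs_le_linf[of x l] a0[of "linf x"] by linarith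
    have "lap ?f x = ?g i + (?g j + (\<Sum>l\<in>UNIV - {i} - {j}. ?g l))"
      unfolding lap_def using j(1) by (subst sum.remove[of _ i], simp, simp, subst sum.remove[of _ j]) auto
    moreover have "(\<Sum>l\<in>UNIV - {i} - {j}. ?g l) \<le> 0"
      using le by (intro sum_nonpos) auto
    ultimately show ?thesis
      using ext[OF i] ext[OF j(2)] by simp
  qed
qed

end

text \<open>The cubes take over the excess of at most \<open>d\<close> per site (\<open>d - 1\<close> on the shells
  \<open>m dvd k\<close>, which avoid \<open>Lam m\<close>) that \<open>v\<close> leaves in the cube of radius \<open>R\<close>.
  The multiplicities grow by this excess from shell to shell, and outside they can drop by 1
  at each shell \<open>m dvd k\<close>; this takes \<open>m\<close> times as many shells.\<close>

lemma toppled_sites_background_subset: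
  fixes e :: "nat \<Rightarrow> int ^ 'd::finite" and v :: "int ^ 'd \<Rightarrow> int"
  assumes e: "bij e" and m: "m \<ge> 1" and v0: "\<And>x. v x \<ge> 0"
    and v: "\<And>x. lap v x + int n * indicator {0} x \<le> int CARD('d)"
    and R: "\<And>x. linf x > R \<Longrightarrow> v x = 0"
  shows "toppled_sites e (background m) n \<subseteq> {x. linf x \<le> m * CARD('d) * (R + 2)}"
proof -
  define d where "d = CARD('d)"
  have d: "d \<ge> 1"
    by (simp add: d_def Suc_leI)
  \<comment> \<open>Growth continues up to shell \<open>R + 1\<close> because \<open>lap v\<close>
    may be nonzero one step beyond the support of \<open>v\<close>. The \<open>+ 1\<close> keeps
    \<open>a k \<ge> d\<close> up to that shell, so that the origin and the corner term
    \<open>- 2 * a k\<close> are covered as well.\<close>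
  define a where "a k = max 0 (int d * (min (int k) (int R + 1) + 1) - int (k div m))" for k
  define r where "r = m * d * (R + 2)"
  have a0: "a k \<ge> 0" for k
    by (simp add: a_def)
  have ar: "a k = 0" if "k \<ge> r" for k
  proof -
    have "k div m \<ge> d * (R + 2)"
      using div_le_mono[OF that, of m] m by (simp add: r_def mult.assoc)
    then have "int (k div m) \<ge> int d * (int R + 2)"
      by (metis of_nat_add of_nat_le_iff of_nat_mult of_nat_numeral)
    moreover have "int d * (min (int k) (int R + 1) + 1) \<le> int d * (int R + 2)"
      by (intro mult_left_mono) auto
    ultimately show ?thesis
      by (simp add: a_def)
  qed
  have div_step: "int (Suc k div m) = int (k div m) + (if m dvd Suc k then 1 else 0)" for k
    using m by (simp add: div_Suc dvd_eq_mod_eq_0)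
  have a_in: "a k = int d * (int k + 1) - int (k div m)" "a k \<ge> int d" if "k \<le> R + 1" for k
  proof -
    have "int (k div m) \<le> int d * int k"
      using d by (metis div_le_dividend le_trans mult_le_mono1 nat_mult_1 of_nat_le_iff of_nat_mult)
    moreover have "min (int k) (int R + 1) = int k"
      using that by simp
    ultimately show "a k = int d * (int k + 1) - int (k div m)" "a k \<ge> int d"
      by (simp_all add: a_def algebra_simps)
  qed
  have inside: "a k - a (Suc k) = (if m dvd Suc k then 1 else 0) - int d" if "k \<le> R" for k
    using a_in(1)[of k] a_in(1)[of "Suc k"] that div_step[of k] by (simp add: algebra_simps)
  have outside: "a k - a (Suc k) \<le> (if m dvd Suc k then 1 else 0)" if "k > R" for k
  proof -
    have "min (int k) (int R + 1) = int R + 1" "min (int (Suc k)) (int R + 1) = int R + 1"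
      using that by auto
    then show ?thesis
      using div_step[of k] by (cases "m dvd Suc k") (simp_all add: a_def max_def)
  qed
  have Lam: "x \<notin> Lam m" if "m dvd linf x" for x :: "int ^ 'd"
  proof -
    obtain i where "\<bar>x $ i\<bar> = int (linf x)"
      by (rule linf_attained)
    then have "int m dvd x $ i"
      using that by (metis dvd_abs_iff int_dvd_int_iff)
    then show ?thesis
      by (auto simp: Lam_def)
  qed
  define w where "w x = v x + cubes a r x" for x
  have "add_origin (background m) n x + lap w x \<le> 2 * int CARD('d) - 1" for x
  proof -
    have w: "add_origin (background m) n x + lap w x =
        2 * int d - 2 + indicator (Lam m) x + (lap v x + int n * indicator {0} x) + lap (cubes a r) x"
      by (simp add: add_origin_def background_def w_def[abs_def] lap_add d_def)
    have v': "lap v x + int n * indicator {0} x \<le> int d"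
      using v[of x] by (simp add: d_def)
    consider "x = 0" | "x \<noteq> 0" "linf x \<le> R + 1" | "x \<noteq> 0" "linf x > R + 1"
      by linarith
    then show ?thesis
    proof cases
      case 1
      have "lap (cubes a r) x = - 2 * int d * a 0"
        using lap_cubes_0[where a=a, OF a0 ar, of r, where 'd = 'd] 1 by (simp add: d_def)
      also have "\<dots> \<le> - 2 * int d"
        using a_in(2)[of 0] d mult_left_mono[of 1 "a 0" "2 * int d"] by simp
      finally show ?thesis
        using w v' d by (simp add: d_def[symmetric] indicator_def split: if_splits)
    next
      case 2
      then obtain k where k: "linf x = Suc k"
        by (metis linf_eq_0_iff not0_implies_Suc)
      have "lap (cubes a r) x \<le> max (a k - a (Suc k)) (- 2 * a (Suc k))"
        using lap_cubes_le[where a=a, OF a0 ar 2(1), of r] k by simp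
      also have "\<dots> \<le> (if m dvd Suc k then 1 else 0) - int d"
        using inside[of k] a_in(2)[of "Suc k"] 2(2) k d by auto
      finally show ?thesis
        using w v' Lam[of x] k by (auto simp: d_def[symmetric] indicator_def split: if_splits)
    next
      case 3
      then obtain k where k: "linf x = Suc k"
        by (metis linf_eq_0_iff not0_implies_Suc)
      have far: "linf y > R" if "y = x + axis i 1 \<or> y = x - axis i 1" for y i
      proof -
        obtain j where "\<bar>x $ j\<bar> = int (linf x)"
          by (rule linf_attained)
        then have "\<bar>y $ j\<bar> \<ge> int (linf x) - 1"
          using that by (auto simp: axis_def)
        then show ?thesis
          using abs_le_linf[of y j] 3(2) by linarith
      qed
      have "v (x + axis i 1) = 0" "v (x - axis i 1) = 0" "v x = 0" for i
        using R far[of "x + axis i 1" i] far[of "x - axis i 1" i] 3(2) by auto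
      then have "lap v x = 0"
        by (simp add: lap_def)
      moreover have "lap (cubes a r) x \<le> max (a k - a (Suc k)) (- 2 * a (Suc k))"
        using lap_cubes_le[where a=a, OF a0 ar 3(1), of r] k by simp
      moreover have "\<dots> \<le> (if m dvd Suc k then 1 else 0)"
        using outside[of k] a0[of "Suc k"] 3(2) k by auto
      ultimately show ?thesis
        using w Lam[of x] k 3(1) by (auto simp: d_def[symmetric] indicator_def split: if_splits)
    qed
  qed
  moreover have "w x \<ge> 0" for x
    using v0[of x] cubes_nonneg[where a=a, OF a0 ar, of r x] by (simp add: w_def)
  ultimately have "toppled_sites e (background m) n \<subseteq> {x. w x > 0}"
    by (rule toppled_sites_subset[OF e])
  also have "\<dots> \<subseteq> {x. linf x \<le> r}"
  proof
    fix x assume "x \<in> {x. w x > 0}"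
    then have x: "v x > 0 \<or> cubes a r x > 0"
      by (auto simp: w_def)
    have "1 * R \<le> m * d * (R + 2)"
      using m d by (intro mult_le_mono) auto
    then have "R \<le> r"
      by (simp add: r_def)
    then show "x \<in> {x. linf x \<le> r}"
      using x R[of x] cubes_support[where a=a, OF a0 ar, of r x] by (cases "linf x \<le> r") auto
  qed
  finally show ?thesis
    by (simp add: r_def d_def)
qed

text \<open>Nested cubes with multiplicities dropping by one per shell have Laplacian at most 1 off
  the origin, while the value \<open>- 2 * d * n\<close> at the origin absorbs the source.\<close>

lemma exists_finite_supersolution:
  "\<exists>v :: int ^ 'd::finite \<Rightarrow> int. (\<forall>x. v x \<ge> 0) \<and> finite {x. v x \<noteq> 0} \<and>
    (\<forall>x. lap v x + int n * indicator {0} x \<le> int CARD('d))"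
proof -
  define a where "a k = max 0 (int n - int k)" for k
  have a0: "a k \<ge> 0" for k
    by (simp add: a_def)
  have ar: "a k = 0" if "k \<ge> n" for k
    using that by (simp add: a_def)
  have d: "int CARD('d) \<ge> 1"
    by (simp add: Suc_leI int_one_le_iff_zero_less)
  have "lap (cubes a n) x + int n * indicator {0} x \<le> int CARD('d)" for x :: "int ^ 'd"
  proof (cases "x = 0")
    case True
    have "1 \<le> 2 * int CARD('d)"
      using d by linarith
    from mult_right_mono[OF this, of "int n"] have "int n \<le> 2 * int CARD('d) * int n"
      by simp
    then show ?thesis
      using True lap_cubes_0[where a=a, OF a0 ar, of n, where 'd = 'd] by (simp add: a_def)
  next
    case False
    have "max (a (linf x - 1) - a (linf x)) (- 2 * a (linf x)) \<le> 1"
      by (auto simp: a_def)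
    then have "lap (cubes a n) x \<le> 1"
      using lap_cubes_le[where a=a, OF a0 ar False, of n] by (rule order_trans[rotated])
    then have "lap (cubes a n) x \<le> int CARD('d)"
      using d by (rule order_trans)
    then show ?thesis
      using False by simp
  qed
  moreover have "finite {x :: int ^ 'd. cubes a n x \<noteq> 0}"
  proof (rule finite_subset[OF _ finite_linf_le[of n]])
    show "{x :: int ^ 'd. cubes a n x \<noteq> 0} \<subseteq> {x. linf x \<le> n}"
      using cubes_support[where a=a, OF a0 ar, of n] by (metis (mono_tags, lifting) Collect_mono nat_le_linear)
  qed
  ultimately show ?thesis
    using cubes_nonneg[where a=a, OF a0 ar, of n] by blast
qed

section \<open>Minimal supersolutions\<close>

definition edges :: "(int ^ 'd::finite) set \<Rightarrow> nat" where
  "edges S = (\<Sum>i\<in>UNIV. card {x \<in> S. x + axis i 1 \<in> S})"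

definition degree_in :: "(int ^ 'd::finite) set \<Rightarrow> int ^ 'd \<Rightarrow> int" where
  "degree_in S x = (\<Sum>i\<in>UNIV. indicator S (x + axis i 1) + indicator S (x - axis i 1))"

lemma lap_indicator: "lap (indicator S) x = degree_in S x - 2 * int CARD('d) * indicator S x"
  for x :: "int ^ 'd::finite"
  by (simp add: lap_eq degree_in_def)

lemma edges_remove:
  assumes "finite S" "x \<in> S"
  shows "int (edges S) = int (edges (S - {x})) + degree_in S x"
proof -
  have "int (card {y \<in> S. y + axis i 1 \<in> S}) = int (card {y \<in> S - {x}. y + axis i 1 \<in> S - {x}})
      + (indicator S (x + axis i 1) + indicator S (x - axis i 1))" for i
  proof -
    \<comment> \<open>Edges in direction \<open>i\<close> are represented by their lower endpoints:
      \<open>P\<close> holds those of the edges avoiding \<open>x\<close>, \<open>A\<close> and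
      \<open>B\<close> those of the at most two edges at \<open>x\<close>.\<close>
    define P where "P = {y \<in> S - {x}. y + axis i 1 \<in> S - {x}}"
    define A where "A = (if x + axis i 1 \<in> S then {x} else {})"
    define B where "B = (if x - axis i 1 \<in> S then {x - axis i 1} else {})"
    have ne: "x + axis i 1 \<noteq> x" "x - axis i 1 \<noteq> x"
      by (auto simp: axis_eq_0_iff)
    have eq: "{y \<in> S. y + axis i 1 \<in> S} = P \<union> (A \<union> B)"
    proof -
      have "y + axis i 1 = x \<longleftrightarrow> y = x - axis i 1" for y
        by (metis add_diff_cancel_right' diff_add_cancel)
      then show ?thesis
        using assms(2) by (auto simp: P_def A_def B_def)
    qed
    have "finite P"
      using assms(1) by (simp add: P_def)
    have "card {y \<in> S. y + axis i 1 \<in> S} = card P + card (A \<union> B)"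
      unfolding eq using ne \<open>finite P\<close> by (intro card_Un_disjoint) (auto simp: P_def A_def B_def)
    also have "card (A \<union> B) = card A + card B"
      using ne by (intro card_Un_disjoint) (auto simp: A_def B_def)
    finally show ?thesis
      by (simp add: P_def A_def B_def indicator_def)
  qed
  then show ?thesis
    by (simp add: edges_def degree_in_def sum.distrib)
qed

text \<open>Adding \<open>d - 1\<close> to both sides of the second condition turns it into
  stability of the final configuration on the constant background \<open>d - 1\<close>.\<close>

definition supersolution :: "nat \<Rightarrow> (int ^ 'd::finite \<Rightarrow> int) \<Rightarrow> bool" where
  "supersolution n v \<longleftrightarrow>
    (\<forall>x. v x \<ge> 0) \<and> (\<forall>x. lap v x + int n * indicator {0} x \<le> int CARD('d))"

text \<open>Such a \<open>v\<close> is the odometer of the sandpile on the background \<open>d - 1\<close>; only its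
  minimality is used.\<close>

definition minimal_supersolution :: "nat \<Rightarrow> (int ^ 'd::finite \<Rightarrow> int) \<Rightarrow> bool" where
  "minimal_supersolution n v \<longleftrightarrow> supersolution n v \<and> finite {x. v x \<noteq> 0} \<and>
    (\<forall>S\<subseteq>{x. v x > 0}. S \<noteq> {} \<longrightarrow> \<not> supersolution n (\<lambda>x. v x - indicator S x))"

text \<open>A finitely supported supersolution of least total sum qualifies, since subtracting the
  indicator of a nonempty set lowers the sum.\<close>

lemma exists_minimal_supersolution: "\<exists>v. minimal_supersolution n v"
proof -
  let ?P = "\<lambda>v :: int ^ 'a \<Rightarrow> int. supersolution n v \<and> finite {x. v x \<noteq> 0}"
  let ?m = "\<lambda>v :: int ^ 'a \<Rightarrow> int. nat (\<Sum>x | v x \<noteq> 0. v x)"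
  obtain v0 where "?P v0"
    using exists_finite_supersolution[of n, where 'd = 'a] by (auto simp: supersolution_def)
  then obtain v where v: "?P v" and min: "\<And>u. ?P u \<Longrightarrow> ?m v \<le> ?m u"
    using ex_has_least_nat[of ?P v0 ?m] by blast
  have "\<not> supersolution n (\<lambda>x. v x - indicator S x)" if S: "S \<subseteq> {x. v x > 0}" "S \<noteq> {}" for S
  proof
    define u where "u x = v x - indicator S x" for x
    assume "supersolution n (\<lambda>x. v x - indicator S x)"
    then have u: "supersolution n u"
      by (simp add: u_def[abs_def])
    have sub: "{x. u x \<noteq> 0} \<subseteq> {x. v x \<noteq> 0}"
      using S(1) by (auto simp: u_def indicator_def)
    then have "?P u"
      using u v finite_subset by blast
    have "(\<Sum>x | u x \<noteq> 0. u x) = (\<Sum>x | v x \<noteq> 0. u x)"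
      using v sub by (intro sum.mono_neutral_left) auto
    also have "\<dots> < (\<Sum>x | v x \<noteq> 0. v x)"
    proof -
      obtain s where "s \<in> S"
        using S(2) by blast
      then have "v s \<noteq> 0" "u s < v s"
        using S(1) by (auto simp: u_def)
      then show ?thesis
        using v by (intro sum_strict_mono_ex1) (auto simp: u_def indicator_def)
    qed
    finally have "(\<Sum>x | u x \<noteq> 0. u x) < (\<Sum>x | v x \<noteq> 0. v x)" .
    moreover have "(\<Sum>x | u x \<noteq> 0. u x) \<ge> 0"
      using u by (intro sum_nonneg) (auto simp: supersolution_def)
    ultimately show False
      using min[OF \<open>?P u\<close>] by simp
  qed
  then show ?thesis
    using v by (auto simp: minimal_supersolution_def)
qed

context
  fixes n :: nat and v :: "int ^ 'd::finite \<Rightarrow> int"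
  assumes v: "minimal_supersolution n v"
begin

lemma minimal_nonneg: "v x \<ge> 0"
  and minimal_lap: "lap v x + int n * indicator {0} x \<le> int CARD('d)"
  and minimal_finite: "finite {x. v x \<noteq> 0}"
  using v by (auto simp: minimal_supersolution_def supersolution_def)

lemma minimal_lap_le: "lap v x \<le> int CARD('d)"
proof -
  have "int n * indicator {0} x \<ge> 0"
    by simp
  then show ?thesis
    using minimal_lap[of x] by linarith
qed

text \<open>If no such \<open>x\<close> existed, each site of \<open>S\<close> could do with one toppling less.\<close>

lemma burning:
  assumes S: "S \<subseteq> {x. v x > 0}" "S \<noteq> {}"
  obtains x where "x \<in> S"
    "lap v x + int n * indicator {0} x + int CARD('d) - 1 \<ge> degree_in S x"
proof -
  have "\<not> supersolution n (\<lambda>x. v x - indicator S x)"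
    using v S by (auto simp: minimal_supersolution_def)
  moreover have "\<forall>x. v x - indicator S x \<ge> 0"
    using S(1) minimal_nonneg by (auto simp: indicator_def)
  ultimately have "\<not> (\<forall>x. lap (\<lambda>x. v x - indicator S x) x + int n * indicator {0} x \<le> int CARD('d))"
    unfolding supersolution_def by blast
  then obtain x where "lap (\<lambda>x. v x - indicator S x) x + int n * indicator {0} x > int CARD('d)"
    by (auto simp: not_le)
  then have x: "lap v x + int n * indicator {0} x - degree_in S x + 2 * int CARD('d) * indicator S x
      > int CARD('d)"
    by (simp add: lap_diff lap_indicator)
  have "x \<in> S"
  proof (rule ccontr)
    assume "x \<notin> S"
    moreover have "degree_in S x \<ge> 0"
      by (simp add: degree_in_def sum_nonneg)
    ultimately show False
      using x minimal_lap[of x] by simp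
  qed
  then show ?thesis
    using x by (intro that[of x]) simp_all
qed

text \<open>\<open>S\<close> is burnt site by site: each removed site has height at least its degree
  in what is left, and these degrees add up to the number of edges.\<close>

lemma sum_excess_ge_edges:
  assumes "finite S" "S \<subseteq> {x. v x > 0}"
  shows "(\<Sum>x\<in>S. lap v x + int n * indicator {0} x + int CARD('d) - 1) \<ge> int (edges S)"
  using assms
proof (induction "card S" arbitrary: S)
  case 0
  then show ?case
    by (simp add: edges_def)
next
  case (Suc k)
  then have "S \<noteq> {}"
    by auto
  then obtain x where x: "x \<in> S"
    "lap v x + int n * indicator {0} x + int CARD('d) - 1 \<ge> degree_in S x"
    using burning[OF Suc.prems(2)] by blast
  have "int (edges (S - {x})) \<le>
      (\<Sum>y\<in>S - {x}. lap v y + int n * indicator {0} y + int CARD('d) - 1)"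
    using Suc x(1) by (intro Suc.hyps(1)) auto
  then show ?case
    using x Suc.prems(1) edges_remove[OF Suc.prems(1) x(1)] by (subst sum.remove[of _ x]) auto
qed

lemma excess_nonneg:
  assumes "v x > 0" "x \<noteq> 0"
  shows "lap v x \<ge> 1 - int CARD('d)"
proof -
  have "{x} \<subseteq> {x. v x > 0}" "{x} \<noteq> {}"
    using assms by auto
  then obtain y where "y \<in> {x}"
    "lap v y + int n * indicator {0} y + int CARD('d) - 1 \<ge> degree_in {x} y"
    by (rule burning)
  moreover have "degree_in {x} x \<ge> 0"
    by (simp add: degree_in_def sum_nonneg)
  ultimately show ?thesis
    using assms(2) by simp
qed

text \<open>At a site of \<open>{v = \<mu>}\<close> that is extremal for \<open>\<lambda>x. s * (\<Sum>l. x $ l)\<close>, the \<open>d\<close> outer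
  neighbours have smaller \<open>v\<close>; if the others do not have larger \<open>v\<close>, this
  contradicts the lower bound on \<open>lap v\<close>.\<close>

lemma linear_growth:
  assumes s: "\<bar>s\<bar> = (1::int)" and t: "t \<ge> 0"
    and M: "\<And>x. s * x $ i \<ge> t \<Longrightarrow> v x \<le> int M"
  shows "s * x $ i > t + int M \<Longrightarrow> v x = 0"
proof -
  have "\<forall>x. s * x $ i \<ge> t + int j \<longrightarrow> v x \<le> int M - int j" if "j \<le> M" for j
    using that
  proof (induction j)
    case 0
    then show ?case
      using M by simp
  next
    case (Suc j)
    then have IH: "\<And>x. s * x $ i \<ge> t + int j \<Longrightarrow> v x \<le> int M - int j"
      by simp
    show ?case
    proof (rule ccontr)
      define \<mu> where "\<mu> = int M - int j"
      \<comment> \<open>The margin 1 keeps the inner neighbours of \<open>S\<close> in the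
        half-space where the induction hypothesis bounds \<open>v\<close> by \<open>\<mu>\<close>,
        and together with \<open>t \<ge> 0\<close> it keeps the source out of
        \<open>S\<close>.\<close>
      define S where "S = {x. s * x $ i \<ge> t + int j + 1 \<and> v x = \<mu>}"
      define h where "h x = s * (\<Sum>l\<in>UNIV. x $ l)" for x :: "int ^ 'd"
      have \<mu>: "\<mu> \<ge> 1"
        using Suc.prems by (simp add: \<mu>_def)
      assume "\<not> (\<forall>x. s * x $ i \<ge> t + int (Suc j) \<longrightarrow> v x \<le> int M - int (Suc j))"
      then obtain x where "s * x $ i \<ge> t + int (Suc j)" "\<not> v x \<le> int M - int (Suc j)"
        by blast
      then have "x \<in> S"
        using IH[of x] by (simp add: S_def \<mu>_def)
      moreover have "finite S"
        using \<mu> by (intro finite_subset[OF _ minimal_finite]) (auto simp: S_def)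
      ultimately have "Max (h ` S) \<in> h ` S" and Max: "\<And>z. z \<in> S \<Longrightarrow> h z \<le> Max (h ` S)"
        by (auto intro!: Max_in)
      then obtain y where y: "y \<in> S" "\<And>z. z \<in> S \<Longrightarrow> h z \<le> h y"
        by (metis imageE)
      have yS: "s * y $ i \<ge> t + int j + 1" "v y = \<mu>"
        using y(1) by (auto simp: S_def)
      have "v (y + axis l 1) + v (y - axis l 1) - v y - v y \<le> - 1" for l
      proof -
        have ss: "s * s = 1"
          using s by (metis abs_mult_self_eq mult_1)
        have out: "v (y + axis l s) \<le> \<mu> - 1"
        proof -
          have "s * (y + axis l s) $ i \<ge> t + int j + 1"
            using yS(1) ss by (cases "l = i") (simp_all add: axis_def distrib_left)
          moreover have "h (y + axis l s) = h y + 1"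
            using ss by (simp add: h_def axis_def sum.distrib distrib_left)
          then have "y + axis l s \<notin> S"
            using y(2)[of "y + axis l s"] by auto
          ultimately have "v (y + axis l s) \<noteq> \<mu>" "v (y + axis l s) \<le> \<mu>"
            using IH[of "y + axis l s"] by (auto simp: S_def \<mu>_def)
          then show ?thesis
            by simp
        qed
        have "s * (y + axis l (- s)) $ i \<ge> t + int j"
          using yS(1) ss by (cases "l = i") (simp_all add: axis_def right_diff_distrib)
        then have "v (y + axis l (- s)) \<le> \<mu>"
          using IH by (simp add: \<mu>_def)
        with out show ?thesis
          using sum_opposite[OF s, of v y l] yS(2) by simp
      qed
      then have "lap v y \<le> (\<Sum>l\<in>(UNIV :: 'd set). - 1)"
        unfolding lap_def by (intro sum_mono) auto
      moreover have "y \<noteq> 0"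
        using yS(1) t by auto
      ultimately show False
        using excess_nonneg[of y] yS(2) \<mu> by simp
    qed
  qed
  from this[of M] show "s * x $ i > t + int M \<Longrightarrow> v x = 0"
    using minimal_nonneg[of x] by (metis diff_self dual_order.antisym le_refl less_imp_le)
qed

text \<open>As \<open>v \<ge> 0\<close>, one neighbour is bounded by the sum over all neighbours,
  which is \<open>lap v x + 2 * d * v x\<close>. Working with \<open>v + 1\<close> absorbs the bound
  \<open>d\<close> on \<open>lap v x\<close>.\<close>

lemma harnack_step:
  assumes "\<bar>s\<bar> = (1::int)"
  shows "v (x + axis i s) + 1 \<le> 2 * int CARD('d) * (v x + 1)"
proof -
  let ?g = "\<lambda>j. v (x + axis j 1) + v (x - axis j 1)"
  have "?g i \<le> (\<Sum>j\<in>UNIV. ?g j)"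
    using minimal_nonneg by (intro member_le_sum) auto
  moreover have "v (x + axis i s) \<le> ?g i"
    using sum_opposite[OF assms, of v x i] minimal_nonneg[of "x + axis i (-s)"] by simp
  moreover have "int CARD('d) \<ge> 1"
    by (simp add: Suc_leI int_one_le_iff_zero_less)
  ultimately show ?thesis
    using minimal_lap_le[of x] unfolding lap_eq distrib_left by linarith
qed

lemma harnack: "v (x + z) + 1 \<le> (2 * int CARD('d)) ^ nat (\<Sum>i\<in>UNIV. \<bar>z $ i\<bar>) * (v x + 1)"
proof (induction "nat (\<Sum>i\<in>UNIV. \<bar>z $ i\<bar>)" arbitrary: z)
  case 0
  then have "(\<Sum>i\<in>UNIV. \<bar>z $ i\<bar>) = 0"
    by (simp add: order_antisym sum_nonneg)
  then have "z = 0"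
    by (simp add: sum_nonneg_eq_0_iff vec_eq_iff)
  then show ?case
    by simp
next
  case (Suc k)
  then have sum: "(\<Sum>i\<in>UNIV. \<bar>z $ i\<bar>) = int k + 1"
    by linarith
  then obtain i where i: "z $ i \<noteq> 0"
    by (metis (no_types, lifting) abs_zero sum.neutral add.commute of_nat_Suc of_nat_0_eq_iff nat.distinct(1))
  define s :: int where "s = sgn (z $ i)"
  define y where "y = z - axis i s"
  have s: "\<bar>s\<bar> = 1"
    using i by (simp add: s_def)
  have "\<bar>y $ j\<bar> = \<bar>z $ j\<bar> - (if j = i then 1 else 0)" for j
    using i by (auto simp: y_def s_def axis_def sgn_if)
  then have "(\<Sum>i\<in>UNIV. \<bar>y $ i\<bar>) = int k"
    using sum by (simp add: sum_subtractf)
  then have k: "k = nat (\<Sum>i\<in>UNIV. \<bar>y $ i\<bar>)"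
    by simp
  have "v (x + z) + 1 = v ((x + y) + axis i s) + 1"
    by (simp add: y_def)
  also have "\<dots> \<le> 2 * int CARD('d) * (v (x + y) + 1)"
    using s by (rule harnack_step)
  also have "\<dots> \<le> 2 * int CARD('d) * ((2 * int CARD('d)) ^ k * (v x + 1))"
    using Suc.hyps(1)[OF k] k by (intro mult_left_mono) auto
  finally show ?case
    using Suc.hyps(2) by (simp add: mult.assoc flip: Suc.hyps(2))
qed

end

section \<open>A subharmonic potential\<close>

text \<open>An antiderivative of \<open>u powr (- p)\<close>. For \<open>p = d / 2\<close> and
  \<open>u\<close> the squared Euclidean norm it is, up to a factor, the fundamental solution of the
  Laplacian, with the logarithm in dimension 2.\<close>

definition pot :: "real \<Rightarrow> real \<Rightarrow> real" where
  "pot p u = (if p = 1 then ln u else u powr (1 - p) / (1 - p))"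

lemma pot_deriv [derivative_intros]:
  assumes "u > 0"
  shows "(pot p has_real_derivative u powr (- p)) (at u)"
proof (cases "p = 1")
  case True
  have "(ln has_real_derivative u powr (- 1)) (at u)"
    using assms by (auto intro!: derivative_eq_intros simp: powr_minus_divide)
  then show ?thesis
    using True by (simp add: pot_def[abs_def])
next
  case False
  have "((\<lambda>u. u powr (1 - p) / (1 - p)) has_real_derivative u powr (- p)) (at u)"
    using assms False by (auto intro!: derivative_eq_intros)
  then show ?thesis
    using False by (simp add: pot_def[abs_def])
qed

lemma pot_diff_bounds:
  assumes "0 < a" "a \<le> b" "p \<ge> 0"
  shows "pot p b - pot p a \<le> (b - a) * a powr (- p)"
    and "pot p b - pot p a \<ge> (b - a) * b powr (- p)"
proof -
  have "pot p b - pot p a \<le> (b - a) * a powr (- p) \<and> pot p b - pot p a \<ge> (b - a) * b powr (- p)"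
  proof (cases "a = b")
    case False
    then have "a < b"
      using assms by simp
    then obtain z where z: "a < z" "z < b" "pot p b - pot p a = (b - a) * z powr (- p)"
      using MVT2[of a b "pot p" "\<lambda>u. u powr (- p)"] assms pot_deriv by force
    then show ?thesis
      using assms by (auto intro!: mult_left_mono powr_mono2')
  qed simp
  then show "pot p b - pot p a \<le> (b - a) * a powr (- p)"
    "pot p b - pot p a \<ge> (b - a) * b powr (- p)"
    by auto
qed

lemma powr_deriv: "u > 0 \<Longrightarrow> ((\<lambda>u. c * u powr q) has_real_derivative c * q * u powr (q - 1)) (at u)"
  for u :: real
  by (auto intro!: derivative_eq_intros)

text \<open>The factor \<open>2 powr (p + 3)\<close> accounts for the fourth derivative being taken at an
  unknown point, which is at least \<open>P / 2\<close>.\<close>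

lemma pot_taylor:
  assumes p: "p \<ge> 0" and P: "P > 0" and t: "\<bar>t\<bar> \<le> P / 2"
  shows "pot p (P + t) \<ge> pot p P + t * P powr (- p) - p * t ^ 2 / 2 * P powr (- p - 1)
    + p * (p + 1) * t ^ 3 / 6 * P powr (- p - 2)
    - p * (p + 1) * (p + 2) * t ^ 4 / 24 * (2 powr (p + 3) * P powr (- p - 3))"
proof (cases "t = 0")
  case False
  define D where "D k = (if k = 0 then pot p else if k = 1 then (\<lambda>u. 1 * u powr (- p))
    else if k = 2 then (\<lambda>u. - p * u powr (- p - 1))
    else if k = 3 then (\<lambda>u. p * (p + 1) * u powr (- p - 2))
    else (\<lambda>u. - p * (p + 1) * (p + 2) * u powr (- p - 3)))" for k :: nat
  have deriv: "(D m has_real_derivative D (Suc m) u) (at u)" if "m < 4" "u > 0" for m u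
  proof -
    have eq: "- p - 1 - 1 = - p - 2" "- p - 2 - 1 = - p - 3" "- p * (- p - 1) = p * (p + 1)"
      "p * (p + 1) * (- p - 2) = - p * (p + 1) * (p + 2)"
      by (auto simp: algebra_simps)
    from that(1) consider "m = 0" | "m = 1" | "m = 2" | "m = 3"
      by linarith
    then show ?thesis
      using pot_deriv[OF that(2), of p] powr_deriv[OF that(2), of 1 "- p"]
        powr_deriv[OF that(2), of "- p" "- p - 1"] powr_deriv[OF that(2), of "p * (p + 1)" "- p - 2"]
      unfolding eq by cases (simp_all add: D_def)
  qed
  let ?a = "P / 2" and ?b = "3 * P / 2"
  have "\<exists>z. (if P + t < P then P + t < z \<and> z < P else P < z \<and> z < P + t) \<and>
    D 0 (P + t) = (\<Sum>m<4. D m P / fact m * (P + t - P) ^ m) + D 4 z / fact 4 * (P + t - P) ^ 4"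
  proof (rule Taylor[of 4 D "D 0" ?a ?b])
    show "\<forall>m s. m < 4 \<and> ?a \<le> s \<and> s \<le> ?b \<longrightarrow> (D m has_real_derivative D (Suc m) s) (at s)"
      using deriv P by (metis half_gt_zero order_less_le_trans)
  qed (use P t False in \<open>auto simp: abs_le_iff\<close>)
  then obtain z where if_z: "if P + t < P then P + t < z \<and> z < P else P < z \<and> z < P + t"
    and eq: "D 0 (P + t) = (\<Sum>m<4. D m P / fact m * t ^ m) + D 4 z / fact 4 * t ^ 4"
    by auto
  have z: "z \<ge> P / 2"
    using if_z t by (auto simp: abs_le_iff split: if_splits)
  have "z powr (- p - 3) \<le> (P / 2) powr (- p - 3)"
    using z P p by (intro powr_mono2') auto
  also have "\<dots> = 2 powr (p + 3) * P powr (- p - 3)"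
    using P by (simp add: powr_divide) (simp add: powr_diff powr_minus powr_add divide_simps)
  finally have "p * (p + 1) * (p + 2) * t ^ 4 / 24 * z powr (- p - 3) \<le>
    p * (p + 1) * (p + 2) * t ^ 4 / 24 * (2 powr (p + 3) * P powr (- p - 3))"
    using p by (intro mult_left_mono) auto
  moreover have "(\<Sum>m<4. D m P / fact m * t ^ m) = pot p P + t * P powr (- p)
    - p * t ^ 2 / 2 * P powr (- p - 1) + p * (p + 1) * t ^ 3 / 6 * P powr (- p - 2)"
    by (simp add: D_def numeral_eq_Suc lessThan_Suc mult_ac)
  moreover have "D 4 z / fact 4 * t ^ 4 = - (p * (p + 1) * (p + 2) * t ^ 4 / 24 * z powr (- p - 3))"
    by (simp add: D_def fact_numeral)
  ultimately show ?thesis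
    using eq by (simp add: D_def)
qed simp

text \<open>The odd terms of the expansions at \<open>t\<close> and \<open>- t\<close> cancel, so
  the error is of fourth order.\<close>

lemma pot_second_difference:
  assumes p: "p \<ge> 0" and P: "P > 0" and t: "\<bar>t\<bar> \<le> P / 2"
  shows "pot p (P + t) + pot p (P - t) - 2 * pot p P \<ge> - p * t\<^sup>2 * P powr (- p - 1)
    - p * (p + 1) * (p + 2) * t ^ 4 / 12 * (2 powr (p + 3) * P powr (- p - 3))"
proof -
  define c1 c2 c3 c4 where "c1 = P powr (- p)" and "c2 = p * P powr (- p - 1)"
    and "c3 = p * (p + 1) / 6 * P powr (- p - 2)"
    and "c4 = p * (p + 1) * (p + 2) * (2 powr (p + 3) * P powr (- p - 3))"
  have "pot p (P + s) \<ge> pot p P + s * c1 - s\<^sup>2 * c2 / 2 + s ^ 3 * c3 - s ^ 4 * c4 / 24"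
    if "\<bar>s\<bar> \<le> P / 2" for s
    using pot_taylor[OF p P that] by (simp add: c1_def c2_def c3_def c4_def mult_ac)
  from this[of t] this[of "- t"]
  have "pot p (P + t) + pot p (P - t) - 2 * pot p P \<ge> - t\<^sup>2 * c2 - t ^ 4 * c4 / 12"
    using t by simp
  then show ?thesis
    by (simp add: c2_def c4_def mult_ac)
qed

definition sqnorm :: "int ^ 'd::finite \<Rightarrow> real" where
  "sqnorm x = (\<Sum>i\<in>UNIV. (real_of_int (x $ i))\<^sup>2)"

lemma sqnorm_nonneg: "sqnorm x \<ge> 0"
  by (simp add: sqnorm_def sum_nonneg)

lemma sqnorm_shift:
  "sqnorm (x + axis i 1) = sqnorm x + 1 + 2 * real_of_int (x $ i)"
  "sqnorm (x - axis i 1) = sqnorm x + 1 - 2 * real_of_int (x $ i)"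
proof -
  have "(real_of_int ((x + axis i 1) $ j))\<^sup>2 =
      (real_of_int (x $ j))\<^sup>2 + (if j = i then 1 + 2 * real_of_int (x $ i) else 0)"
    "(real_of_int ((x - axis i 1) $ j))\<^sup>2 =
      (real_of_int (x $ j))\<^sup>2 + (if j = i then 1 - 2 * real_of_int (x $ i) else 0)" for j
    by (auto simp: axis_def power2_eq_square algebra_simps)
  then show "sqnorm (x + axis i 1) = sqnorm x + 1 + 2 * real_of_int (x $ i)"
    "sqnorm (x - axis i 1) = sqnorm x + 1 - 2 * real_of_int (x $ i)"
    unfolding sqnorm_def by (simp_all add: sum.distrib)
qed

lemma lap_sqnorm: "lap sqnorm (x :: int ^ 'd::finite) = 2 * real CARD('d)"
  by (simp add: lap_def sqnorm_shift)

lemma coord_sq_le_sqnorm: "(real_of_int (x $ i))\<^sup>2 \<le> sqnorm x"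
  unfolding sqnorm_def by (rule member_le_sum) auto

lemma sum_fourth_le: "(\<Sum>i\<in>UNIV. (real_of_int (x $ i)) ^ 4) \<le> (sqnorm x)\<^sup>2"
proof -
  have "(\<Sum>i\<in>UNIV. (real_of_int (x $ i)) ^ 4) \<le> (\<Sum>i\<in>UNIV. (real_of_int (x $ i))\<^sup>2 * sqnorm x)"
  proof (rule sum_mono)
    fix i
    have "(real_of_int (x $ i)) ^ 4 = (real_of_int (x $ i))\<^sup>2 * (real_of_int (x $ i))\<^sup>2"
      by (simp flip: power_add)
    then show "(real_of_int (x $ i)) ^ 4 \<le> (real_of_int (x $ i))\<^sup>2 * sqnorm x"
      using coord_sq_le_sqnorm[of x i] by (metis mult_left_mono zero_le_power2)
  qed
  then show ?thesis
    by (simp add: sqnorm_def power2_eq_square flip: sum_distrib_right)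
qed

text \<open>The continuous Laplacian of \<open>pot (d / 2) (\<bar>x\<bar>\<^sup>2 + A)\<close> is
  \<open>2 d A (\<bar>x\<bar>\<^sup>2 + A) powr (- d / 2 - 1)\<close>. Discretization changes it by
  \<open>O((\<bar>x\<bar>\<^sup>2 + A) powr (- d / 2 - 1))\<close>, so it remains nonnegative if \<open>A\<close> is large.\<close>

lemma exists_subharmonic_pot:
  "\<exists>A>0. \<forall>x :: int ^ 'd::finite. lap (\<lambda>x. pot (real CARD('d) / 2) (sqnorm x + A)) x \<ge> 0"
proof -
  define d where "d = real CARD('d)"
  have d: "d \<ge> 1"
    unfolding d_def by (simp add: Suc_leI)
  define p where "p = d / 2"
  define C where "C = p * (p + 1) * (p + 2) * (4 / 3) * 2 powr (p + 3)"
  \<comment> \<open>\<open>2 * d * A \<ge> C\<close> lets the main term beat the discretization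
    error; \<open>A \<ge> 3\<close> keeps increments within the range \<open>P / 2\<close> of the
    Taylor bound.\<close>
  define A where "A = max 3 (C / (2 * d))"
  have p: "p > 0"
    using d by (simp add: p_def)
  have A3: "A \<ge> 3" and AC: "2 * d * A \<ge> C"
    using d by (auto simp: A_def divide_simps max_def mult.commute split: if_splits)
  have "lap (\<lambda>x. pot p (sqnorm x + A)) x \<ge> 0" for x :: "int ^ 'd"
  proof -
    define s where "s = sqnorm x"
    \<comment> \<open>Unit steps along axis \<open>i\<close> change \<open>sqnorm x + A\<close> to
      \<open>P + 2 * x $ i\<close> and \<open>P - 2 * x $ i\<close>, so expanding about
      \<open>P\<close> makes the increments symmetric.\<close>
    define P where "P = s + A + 1"
    have s: "s \<ge> 0"
      by (simp add: s_def sqnorm_nonneg)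
    have P: "P > 0"
      using s A3 by (simp add: P_def)
    define q where "q = P powr (- p - 1)"
    have q: "P powr (- p) = P * q" "P powr (- p - 3) = q / P\<^sup>2" "q > 0"
      using P by (auto simp: q_def powr_diff powr_minus field_simps eval_nat_numeral)
    have direction: "pot p (P + 2 * t) + pot p (P - 2 * t) - pot p (s + A) - pot p (s + A) \<ge>
      2 * P * q - 4 * p * q * t\<^sup>2 - C * q * (t ^ 4 / P\<^sup>2)" (is "?L \<ge> ?R")
      if t: "t\<^sup>2 \<le> s" for t
    proof -
      have "2 * \<bar>t\<bar> \<le> P / 2"
      proof -
        have "(\<bar>t\<bar> - 2)\<^sup>2 \<ge> 0"
          by simp
        then have "4 * \<bar>t\<bar> \<le> t\<^sup>2 + 4"
          by (simp add: power2_diff)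
        then show ?thesis
          using t A3 by (simp add: P_def)
      qed
      then have "\<bar>2 * t\<bar> \<le> P / 2"
        by simp
      from pot_second_difference[OF less_imp_le[OF p] P this]
      have "pot p (P + 2 * t) + pot p (P - 2 * t) - 2 * pot p P \<ge>
        - p * (2 * t)\<^sup>2 * q - p * (p + 1) * (p + 2) * (2 * t) ^ 4 / 12 * (2 powr (p + 3) * (q / P\<^sup>2))"
        by (simp only: q(2) q_def[symmetric])
      also have "- p * (2 * t)\<^sup>2 * q - p * (p + 1) * (p + 2) * (2 * t) ^ 4 / 12 * (2 powr (p + 3) * (q / P\<^sup>2))
        = - 4 * p * q * t\<^sup>2 - C * q * (t ^ 4 / P\<^sup>2)"
        by (simp add: C_def power_mult_distrib)
      finally have "pot p (P + 2 * t) + pot p (P - 2 * t) - 2 * pot p P \<ge>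
        - 4 * p * q * t\<^sup>2 - C * q * (t ^ 4 / P\<^sup>2)" .
      moreover have "pot p P - pot p (s + A) \<ge> P * q"
        using pot_diff_bounds(2)[of "s + A" P p] s A3 p q(1) by (simp add: P_def)
      ultimately show ?thesis
        by linarith
    qed
    have "0 \<le> q * (2 * d * (P - s) - C)"
      using q(3) AC d by (intro mult_nonneg_nonneg) (auto simp: P_def algebra_simps)
    also have "\<dots> = 2 * d * P * q - 4 * p * q * s - C * q * 1"
      by (simp add: p_def algebra_simps)
    also have "\<dots> \<le> 2 * d * P * q - 4 * p * q * s - C * q * ((\<Sum>i\<in>UNIV. (real_of_int (x $ i)) ^ 4) / P\<^sup>2)"
    proof -
      have "(\<Sum>i\<in>UNIV. (real_of_int (x $ i)) ^ 4) \<le> P\<^sup>2"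
        using s A3 by (intro order_trans[OF sum_fourth_le]) (auto simp: P_def s_def intro!: power_mono)
      then have "(\<Sum>i\<in>UNIV. (real_of_int (x $ i)) ^ 4) / P\<^sup>2 \<le> 1"
        using P by (simp add: divide_simps)
      moreover have "C * q \<ge> 0"
        using p q(3) by (simp add: C_def)
      ultimately show ?thesis
        by (intro diff_left_mono mult_left_mono)
    qed
    also have "\<dots> = (\<Sum>i\<in>UNIV. 2 * P * q - 4 * p * q * (real_of_int (x $ i))\<^sup>2 -
        C * q * ((real_of_int (x $ i)) ^ 4 / P\<^sup>2))"
      by (simp add: sum_subtractf d_def s_def sqnorm_def sum_distrib_left sum_divide_distrib)
    also have "\<dots> \<le> lap (\<lambda>x. pot p (sqnorm x + A)) x"
      unfolding lap_def
    proof (rule sum_mono)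
      fix i
      have "sqnorm (x + axis i 1) + A = P + 2 * real_of_int (x $ i)"
        "sqnorm (x - axis i 1) + A = P - 2 * real_of_int (x $ i)"
        by (simp_all add: sqnorm_shift P_def s_def)
      then show "2 * P * q - 4 * p * q * (real_of_int (x $ i))\<^sup>2 - C * q * ((real_of_int (x $ i)) ^ 4 / P\<^sup>2)
        \<le> pot p (sqnorm (x + axis i 1) + A) + pot p (sqnorm (x - axis i 1) + A) -
          pot p (sqnorm x + A) - pot p (sqnorm x + A)"
        using direction[of "real_of_int (x $ i)"] coord_sq_le_sqnorm[of x i] by (simp add: s_def)
    qed
    finally show ?thesis .
  qed
  then show ?thesis
    using A3 by (intro exI[of _ A]) (auto simp: p_def d_def)
qed

section \<open>Flux of the potential through lattice balls\<close>

definition lball :: "real \<Rightarrow> (int ^ 'd::finite) set" where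
  "lball R = {x. sqnorm x \<le> R\<^sup>2}"

lemma finite_lball: "finite (lball R :: (int ^ 'd::finite) set)"
proof (rule finite_subset[OF _ finite_bounded_sites[of "\<lfloor>\<bar>R\<bar>\<rfloor>"]])
  show "(lball R :: (int ^ 'd) set) \<subseteq> {x. \<forall>i. \<bar>x $ i\<bar> \<le> \<lfloor>\<bar>R\<bar>\<rfloor>}"
  proof (intro subsetI CollectI allI)
    fix x :: "int ^ 'd" and i
    assume "x \<in> lball R"
    then have "(real_of_int (x $ i))\<^sup>2 \<le> R\<^sup>2"
      using coord_sq_le_sqnorm[of x i] by (simp add: lball_def)
    then have "\<bar>real_of_int (x $ i)\<bar> \<le> \<bar>R\<bar>"
      by (simp add: abs_le_square_iff)
    then show "\<bar>x $ i\<bar> \<le> \<lfloor>\<bar>R\<bar>\<rfloor>"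
      by (simp add: le_floor_iff)
  qed
qed

section \<open>Volume bound for lattice balls\<close>

definition real_vec :: "int ^ 'd \<Rightarrow> real ^ 'd::finite" where
  "real_vec x = (\<chi> i. real_of_int (x $ i))"

lemma real_vec_nth [simp]: "real_vec x $ i = real_of_int (x $ i)"
  by (simp add: real_vec_def)

lemma norm_real_vec: "(norm (real_vec x))\<^sup>2 = sqnorm x"
  unfolding power2_norm_eq_inner inner_vec_def sqnorm_def by (simp add: power2_eq_square)

lemma norm_le_card:
  fixes y :: "real ^ 'd::finite"
  assumes "\<And>i. \<bar>y $ i\<bar> \<le> c"
  shows "norm y \<le> c * real CARD('d)"
proof -
  have "norm y \<le> (\<Sum>i\<in>UNIV. \<bar>y $ i\<bar>)"
    by (rule norm_le_l1_cart)
  also have "\<dots> \<le> (\<Sum>i\<in>(UNIV :: 'd set). c)"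
    by (intro sum_mono assms)
  finally show ?thesis
    by (simp add: mult.commute)
qed

text \<open>Unit cubes with lower corners in the lattice ball cover the ball shrunk by
  \<open>d\<close>, a crude bound on the diameter of a unit cube.\<close>

lemma card_lball_ge:
  assumes R: "R \<ge> real CARD('d)"
  shows "measure lborel (ball (0 :: real ^ 'd::finite) 1) * (R - real CARD('d)) ^ CARD('d)
    \<le> real (card (lball R :: (int ^ 'd) set))"
proof -
  let ?Q = "\<lambda>x :: int ^ 'd. cbox (real_vec x) (real_vec x + 1)"
  let ?r = "R - real CARD('d)"
  have sub: "ball 0 ?r \<subseteq> (\<Union>x\<in>lball R. ?Q x)"
  proof
    fix y :: "real ^ 'd" assume y: "y \<in> ball 0 ?r"
    define x :: "int ^ 'd" where "x = (\<chi> i. \<lfloor>y $ i\<rfloor>)"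
    have frac: "real_of_int \<lfloor>y $ i\<rfloor> \<le> y $ i" "y $ i \<le> real_of_int \<lfloor>y $ i\<rfloor> + 1" for i
      by linarith+
    then have "norm (real_vec x - y) \<le> 1 * real CARD('d)"
      by (intro norm_le_card) (auto simp: x_def abs_le_iff algebra_simps)
    then have "norm (real_vec x) \<le> R"
      using norm_triangle_ineq[of y "real_vec x - y"] y by simp
    then have "(norm (real_vec x))\<^sup>2 \<le> R\<^sup>2"
      by (simp add: power_mono)
    then have "x \<in> lball R"
      by (simp add: lball_def norm_real_vec)
    moreover have "y \<in> ?Q x"
      using frac by (simp add: mem_box_cart x_def)
    ultimately show "y \<in> (\<Union>x\<in>lball R. ?Q x)"
      by blast
  qed
  have content: "measure lborel (?Q x) = 1" for x
  proof -
    have "?Q x \<noteq> {}"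
      by (simp add: interval_ne_empty_cart)
    then show ?thesis
      by (simp add: content_cbox_cart)
  qed
  have "measure lborel (ball (0 :: real ^ 'd) ?r) \<le> measure lborel (\<Union>x\<in>lball R. ?Q x)"
  proof (rule measure_mono_fmeasurable[OF sub])
    show "(\<Union>x\<in>lball R. ?Q x) \<in> fmeasurable lborel"
      by (intro fmeasurable.finite_UN finite_lball) auto
  qed auto
  also have "\<dots> \<le> (\<Sum>x\<in>lball R. measure lborel (?Q x))"
    by (intro measure_UNION_le finite_lball) auto
  finally have "measure lborel (ball (0 :: real ^ 'd) ?r) \<le> real (card (lball R :: (int ^ 'd) set))"
    by (simp add: content)
  then show ?thesis
    using R by (simp add: content_ball)
qed

text \<open>A discrete divergence theorem: differences along edges inside \<open>B\<close> cancel in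
  pairs, and only those across the boundary remain.\<close>

lemma sum_lap_nonpos:
  fixes G :: "int ^ 'd::finite \<Rightarrow> real"
  assumes fin: "finite B"
    and plus: "\<And>x i. x \<in> B \<Longrightarrow> x + axis i 1 \<notin> B \<Longrightarrow> G (x + axis i 1) \<le> G x"
    and minus: "\<And>x i. x \<in> B \<Longrightarrow> x - axis i 1 \<notin> B \<Longrightarrow> G (x - axis i 1) \<le> G x"
  shows "(\<Sum>x\<in>B. lap G x) \<le> 0"
proof -
  have "(\<Sum>x\<in>B. (G (x + axis i 1) - G x) + (G (x - axis i 1) - G x)) \<le> 0" for i
  proof -
    define P where "P = {x \<in> B. x + axis i 1 \<in> B}"
    define Q where "Q = {x \<in> B. x - axis i 1 \<in> B}"
    have sub: "P \<subseteq> B" "Q \<subseteq> B"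
      by (auto simp: P_def Q_def)
    have "(\<Sum>x\<in>Q. G (x - axis i 1) - G x) = (\<Sum>x\<in>P. - (G (x + axis i 1) - G x))"
      by (rule sum.reindex_bij_witness[of _ "\<lambda>x. x + axis i 1" "\<lambda>x. x - axis i 1"])
        (auto simp: P_def Q_def)
    then have "(\<Sum>x\<in>P. G (x + axis i 1) - G x) + (\<Sum>x\<in>Q. G (x - axis i 1) - G x) = 0"
      by (simp add: sum_negf sum_subtractf)
    moreover have "(\<Sum>x\<in>B - P. G (x + axis i 1) - G x) \<le> 0" "(\<Sum>x\<in>B - Q. G (x - axis i 1) - G x) \<le> 0"
      by (intro sum_nonpos; simp add: P_def Q_def plus minus)+
    ultimately show ?thesis
      using sum.subset_diff[OF sub(1) fin, of "\<lambda>x. G (x + axis i 1) - G x"]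
        sum.subset_diff[OF sub(2) fin, of "\<lambda>x. G (x - axis i 1) - G x"]
      unfolding sum.distrib by linarith
  qed
  then have "(\<Sum>i\<in>UNIV. \<Sum>x\<in>B. (G (x + axis i 1) - G x) + (G (x - axis i 1) - G x)) \<le> 0"
    by (rule sum_nonpos)
  also have "(\<Sum>i\<in>UNIV. \<Sum>x\<in>B. (G (x + axis i 1) - G x) + (G (x - axis i 1) - G x)) = (\<Sum>x\<in>B. lap G x)"
    by (subst sum.swap) (simp add: lap_def algebra_simps)
  finally show ?thesis .
qed

text \<open>The flux of \<open>pot p (sqnorm x + A)\<close> through the boundary of a ball is
  compared with that of a multiple of \<open>sqnorm\<close>, whose Laplacian is constant.\<close>

lemma sum_lap_pot_ge:
  assumes A: "A > 0" and p: "p \<ge> 0" and R: "R \<ge> 0"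
  shows "(\<Sum>x\<in>(lball R :: (int ^ 'd::finite) set). lap (\<lambda>x. pot p (sqnorm x + A)) x) \<ge>
    ((R + 1)\<^sup>2 + A) powr (- p) * (2 * real CARD('d) * real (card (lball R :: (int ^ 'd) set)))"
proof -
  \<comment> \<open>The slope of \<open>pot\<close> at the largest argument reached just outside the
    ball. Slopes decrease, so increments of the potential across the boundary are at least
    \<open>\<kappa>\<close> times those of \<open>sqnorm\<close>.\<close>
  define \<kappa> where "\<kappa> = ((R + 1)\<^sup>2 + A) powr (- p)"
  define G where "G x = \<kappa> * sqnorm x - pot p (sqnorm x + A)" for x :: "int ^ 'd"
  have G: "G y \<le> G x" if "x \<in> lball R" "y \<notin> lball R"
    "sqnorm y = sqnorm x + 1 + 2 * t" "t\<^sup>2 \<le> sqnorm x" for x y t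
  proof -
    have xy: "sqnorm x \<le> R\<^sup>2" "R\<^sup>2 < sqnorm y"
      using that by (auto simp: lball_def)
    have "t \<le> R"
      using power2_le_imp_le[of t R] that(4) xy(1) R by linarith
    then have y: "sqnorm y \<le> (R + 1)\<^sup>2"
      using that(3) xy(1) by (simp add: power2_sum)
    have "(sqnorm y - sqnorm x) * \<kappa> \<le> (sqnorm y - sqnorm x) * (sqnorm y + A) powr (- p)"
      unfolding \<kappa>_def using y A p xy sqnorm_nonneg[of y]
      by (intro mult_left_mono powr_mono2') auto
    also have "\<dots> \<le> pot p (sqnorm y + A) - pot p (sqnorm x + A)"
      using pot_diff_bounds(2)[of "sqnorm x + A" "sqnorm y + A" p] A p xy sqnorm_nonneg[of x] by simp
    finally show ?thesis
      by (simp add: G_def algebra_simps)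
  qed
  have "(\<Sum>x\<in>lball R. lap G x) \<le> 0"
  proof (rule sum_lap_nonpos[OF finite_lball])
    fix x :: "int ^ 'd" and i
    assume x: "x \<in> lball R"
    show "G (x + axis i 1) \<le> G x" if "x + axis i 1 \<notin> lball R"
      using x that coord_sq_le_sqnorm[of x i] by (intro G) (auto simp: sqnorm_shift)
    show "G (x - axis i 1) \<le> G x" if "x - axis i 1 \<notin> lball R"
      using x that coord_sq_le_sqnorm[of x i]
      by (intro G[of _ _ "- real_of_int (x $ i)"]) (auto simp: sqnorm_shift)
  qed
  moreover have "lap G = (\<lambda>x. \<kappa> * (2 * real CARD('d)) - lap (\<lambda>x. pot p (sqnorm x + A)) x)"
    unfolding G_def[abs_def] lap_diff lap_mult fun_eq_iff by (simp add: lap_sqnorm)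
  ultimately show ?thesis
    by (simp add: sum_subtractf \<kappa>_def mult_ac)
qed

lemma unit_ball_measure_pos: "measure lborel (ball (0 :: real ^ 'd::finite) 1) > 0"
  by (simp add: content_ball_pos)

text \<open>\<open>2 * d * \<omega>\<close> is the flux of the continuous potential through any
  sphere about the origin. The lower bound from \<open>sum_lap_pot_ge\<close> and
  \<open>card_lball_ge\<close> tends to it as \<open>R\<close> grows.\<close>

lemma exists_large_flux:
  assumes A: "A > 0" and b: "b < 1"
  shows "\<exists>R. (\<Sum>x\<in>(lball R :: (int ^ 'd::finite) set). lap (\<lambda>x. pot (real CARD('d) / 2) (sqnorm x + A)) x)
    \<ge> b * (2 * real CARD('d) * measure lborel (ball (0 :: real ^ 'd) 1))"
proof -
  define d where "d = real CARD('d)"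
  define \<omega> where "\<omega> = measure lborel (ball (0 :: real ^ 'd) 1)"
  define S where "S R = (\<Sum>x\<in>(lball R :: (int ^ 'd) set). lap (\<lambda>x. pot (d / 2) (sqnorm x + A)) x)" for R
  have d: "d > 0"
    by (simp add: d_def)
  have "((\<lambda>R. (R - d)\<^sup>2 / ((R + 1)\<^sup>2 + A)) \<longlongrightarrow> 1) at_top"
    by real_asymp
  then have "((\<lambda>R. ((R - d)\<^sup>2 / ((R + 1)\<^sup>2 + A)) powr (d / 2)) \<longlongrightarrow> 1 powr (d / 2)) at_top"
    by (intro tendsto_powr tendsto_const) auto
  then have "eventually (\<lambda>R. ((R - d)\<^sup>2 / ((R + 1)\<^sup>2 + A)) powr (d / 2) > b) at_top"
    using b by (intro order_tendstoD) auto
  moreover have "eventually (\<lambda>R. R > d) at_top"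
    by (rule eventually_gt_at_top)
  ultimately have "eventually (\<lambda>R. S R \<ge> b * (2 * d * \<omega>)) at_top"
  proof eventually_elim
    case (elim R)
    have "(R - d) ^ CARD('d) = (R - d) powr d"
      using elim by (simp add: d_def powr_realpow)
    also have "\<dots> = ((R - d)\<^sup>2) powr (d / 2)"
      using elim by (simp add: powr_powr flip: powr_numeral)
    finally have "(R - d) ^ CARD('d) * ((R + 1)\<^sup>2 + A) powr (- (d / 2)) =
        ((R - d)\<^sup>2) powr (d / 2) / ((R + 1)\<^sup>2 + A) powr (d / 2)"
      by (simp only: powr_minus divide_inverse)
    also have "\<dots> = ((R - d)\<^sup>2 / ((R + 1)\<^sup>2 + A)) powr (d / 2)"
      by (rule powr_divide[symmetric])
    finally have "(R - d) ^ CARD('d) * ((R + 1)\<^sup>2 + A) powr (- (d / 2)) =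
        ((R - d)\<^sup>2 / ((R + 1)\<^sup>2 + A)) powr (d / 2)" .
    then have "b \<le> (R - d) ^ CARD('d) * ((R + 1)\<^sup>2 + A) powr (- (d / 2))"
      using elim by simp
    then have "b * (2 * d * \<omega>) \<le> (R - d) ^ CARD('d) * ((R + 1)\<^sup>2 + A) powr (- (d / 2)) * (2 * d * \<omega>)"
      using d by (intro mult_right_mono) (auto simp: \<omega>_def)
    also have "\<dots> = ((R + 1)\<^sup>2 + A) powr (- (d / 2)) * (2 * d * (\<omega> * (R - d) ^ CARD('d)))"
      by simp
    also have "\<dots> \<le> ((R + 1)\<^sup>2 + A) powr (- (d / 2)) * (2 * d * real (card (lball R :: (int ^ 'd) set)))"
      using card_lball_ge[of R, where 'd = 'd] elim d
      by (intro mult_left_mono) (auto simp: \<omega>_def d_def)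
    also have "\<dots> \<le> S R"
      unfolding S_def d_def using sum_lap_pot_ge[OF A, of "d / 2" R, where 'd = 'd] elim d
      by (simp add: d_def)
    finally show ?case .
  qed
  then obtain R where "S R \<ge> b * (2 * d * \<omega>)"
    using eventually_happens'[of at_top] by (metis trivial_limit_at_top_linorder)
  then show ?thesis
    by (auto simp: S_def d_def \<omega>_def)
qed

section \<open>Sites and edges of boxes\<close>

lemma card_vec_box: "card {y :: 'a ^ 'd::finite. \<forall>i. y $ i \<in> S i} = (\<Prod>i\<in>UNIV. card (S i))"
proof -
  have "bij_betw vec_lambda (Pi\<^sub>E UNIV S) {y :: 'a ^ 'd. \<forall>i. y $ i \<in> S i}"
    by (rule bij_betwI[where g = vec_nth]) auto
  then show ?thesis
    by (simp add: bij_betw_same_card[symmetric] card_PiE)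
qed

definition box_at :: "int ^ 'd::finite \<Rightarrow> nat \<Rightarrow> (int ^ 'd) set" where
  "box_at p k = {y. \<forall>i. y $ i \<in> {p $ i..<p $ i + int k}}"

lemma card_box_at: "card (box_at p k :: (int ^ 'd::finite) set) = k ^ CARD('d)"
  by (simp add: box_at_def card_vec_box del: atLeastLessThan_iff)

lemma edges_box_at:
  assumes "k \<ge> 1"
  shows "edges (box_at p k :: (int ^ 'd::finite) set) = CARD('d) * (k ^ (CARD('d) - 1) * (k - 1))"
proof -
  have "card {x \<in> box_at p k. x + axis i 1 \<in> box_at p k} = k ^ (CARD('d) - 1) * (k - 1)" for i :: 'd
  proof -
    have "y $ j \<in> {p $ j..<p $ j + int k} \<and> (y + axis i 1) $ j \<in> {p $ j..<p $ j + int k} \<longleftrightarrow>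
      y $ j \<in> {p $ j..<p $ j + int (if j = i then k - 1 else k)}" for y j
      using assms by (cases "j = i") (auto simp: axis_def of_nat_diff)
    then have "{x \<in> box_at p k. x + axis i 1 \<in> box_at p k} =
        {y. \<forall>j. y $ j \<in> {p $ j..<p $ j + int (if j = i then k - 1 else k)}}"
      by (simp only: box_at_def mem_Collect_eq all_conj_distrib[symmetric])
    then have "card {x \<in> box_at p k. x + axis i 1 \<in> box_at p k} =
        (\<Prod>j\<in>UNIV. card {p $ j..<p $ j + int (if j = i then k - 1 else k)})"
      by (simp only: card_vec_box)
    also have "\<dots> = (\<Prod>j\<in>UNIV. if j = i then k - 1 else k)"
      by simp
    also have "\<dots> = (k - 1) * (\<Prod>j\<in>UNIV - {i}. k)"
      by (subst prod.remove[of _ i]) auto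
    finally show ?thesis
      by (simp add: card_Diff_singleton)
  qed
  then show ?thesis
    by (simp add: edges_def)
qed

lemma finite_box_at: "finite (box_at p k)"
proof (cases "k = 0")
  case False
  then have "card (box_at p k) > 0"
    by (simp add: card_box_at)
  then show ?thesis
    by (rule card_ge_0_finite)
qed (simp add: box_at_def)

lemma sum_box_at: "sum f (box_at p k) = (\<Sum>z\<in>box_at 0 k. f (p + z))"
  by (rule sum.reindex_bij_witness[of _ "\<lambda>z. p + z" "\<lambda>y. y - p"])
    (auto simp: box_at_def algebra_simps)

section \<open>Smoothing and comparison\<close>

text \<open>An average over boxes of side \<open>k\<close>, on which the edge count gives the
  density, combined with weights \<open>K\<close> that spread out the point source.\<close>

definition smooth ::
  "(int ^ 'd \<Rightarrow> real) \<Rightarrow> (int ^ 'd) set \<Rightarrow> nat \<Rightarrow> (int ^ 'd \<Rightarrow> real) \<Rightarrow> int ^ 'd::finite \<Rightarrow> real" where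
  "smooth K Y k u x = (\<Sum>y\<in>Y. K y * ((\<Sum>z\<in>box_at 0 k. u (x + (y + z))) / real k ^ CARD('d)))"

lemma lap_smooth: "lap (smooth K Y k u) x = smooth K Y k (lap u) x"
proof -
  have eq: "smooth K Y k u =
      (\<lambda>x. \<Sum>y\<in>Y. (K y / real k ^ CARD('a)) * (\<Sum>z\<in>box_at 0 k. u (x + (y + z))))" for u
    by (simp add: smooth_def fun_eq_iff)
  show ?thesis
    unfolding eq lap_sum lap_mult lap_shift ..
qed

lemma smooth_mono:
  assumes "\<And>y. y \<in> Y \<Longrightarrow> K y \<ge> 0"
    and "\<And>y z. y \<in> Y \<Longrightarrow> z \<in> box_at 0 k \<Longrightarrow> u (x + (y + z)) \<le> u' (x + (y + z))"
  shows "smooth K Y k u x \<le> smooth K Y k u' x"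
  unfolding smooth_def using assms
  by (intro sum_mono mult_left_mono divide_right_mono) auto

lemma smooth_affine:
  fixes Y :: "(int ^ 'd::finite) set"
  assumes "sum K Y = 1" "k \<ge> 1"
  shows "smooth K Y k (\<lambda>x. a * u x + c) x = a * smooth K Y k u x + c"
proof -
  have k: "real k ^ CARD('d) > 0"
    using assms(2) by simp
  have "(\<Sum>z\<in>box_at 0 k. a * u (x + (y + z)) + c) / real k ^ CARD('d) =
      a * ((\<Sum>z\<in>box_at 0 k. u (x + (y + z))) / real k ^ CARD('d)) + c" for y
    using k by (simp add: sum.distrib card_box_at add_divide_distrib flip: sum_distrib_left)
  then have "smooth K Y k (\<lambda>x. a * u x + c) x =
      (\<Sum>y\<in>Y. a * (K y * ((\<Sum>z\<in>box_at 0 k. u (x + (y + z))) / real k ^ CARD('d))) + K y * c)"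
    unfolding smooth_def by (intro sum.cong refl) (simp add: algebra_simps)
  also have "\<dots> = a * smooth K Y k u x + sum K Y * c"
    unfolding smooth_def sum.distrib sum_distrib_left sum_distrib_right ..
  finally show ?thesis
    using assms(1) by simp
qed

lemma smooth_const:
  assumes "sum K Y = 1" "k \<ge> 1"
  shows "smooth K Y k (\<lambda>x. c) x = c"
  using smooth_affine[OF assms, of 0 "\<lambda>x. 0" c x] by simp

text \<open>The kernel \<open>K\<close> is chosen such that the smoothed point source is
  dominated by the smoothing of \<open>lap f\<close>, so that no Green's function of the lattice is needed.\<close>

lemma smooth_origin_le:
  fixes f :: "int ^ 'd::finite \<Rightarrow> real"
  assumes f: "\<And>x. lap f x \<ge> 0" "\<And>x. f (- x) = f x" and N: "N > 0" and Y: "finite Y"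
  shows "smooth (\<lambda>y. lap f y / N) Y k (indicator {0}) x \<le>
    (\<Sum>z\<in>box_at 0 k. lap f (x + z)) / real k ^ CARD('d) / N"
proof -
  \<comment> \<open>Only \<open>y = - (x + z)\<close> hits the source; evenness turns its weight
    into \<open>lap f (x + z)\<close>.\<close>
  have even: "lap f (- a) = lap f a" for a
  proof -
    have "f (- a + axis i 1) = f (a - axis i 1)" "f (- a - axis i 1) = f (a + axis i 1)" for i
      using f(2)[of "a - axis i 1"] f(2)[of "a + axis i 1"] by (simp_all add: algebra_simps)
    then show ?thesis
      by (simp add: lap_def f(2) add.commute)
  qed
  have le: "(\<Sum>y\<in>Y. lap f y * indicator {0} (x + (y + z))) \<le> lap f (x + z)" for z
  proof -
    have "x + (y + z) = 0 \<longleftrightarrow> y = - (x + z)" for y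
      by (simp only: eq_neg_iff_add_eq_0 add.left_commute)
    then have "(\<Sum>y\<in>Y. lap f y * indicator {0} (x + (y + z))) =
        (\<Sum>y\<in>Y. if y = - (x + z) then lap f y else 0)"
      by (intro sum.cong refl) (auto simp: indicator_def)
    also have "\<dots> \<le> lap f (x + z)"
      using Y f(1)[of "x + z"] even[of "x + z"] by simp
    finally show ?thesis .
  qed
  have "smooth (\<lambda>y. lap f y / N) Y k (indicator {0}) x =
      (\<Sum>y\<in>Y. \<Sum>z\<in>box_at 0 k. lap f y * indicator {0} (x + (y + z))) / real k ^ CARD('d) / N"
    unfolding smooth_def sum_divide_distrib sum_distrib_left
    by (intro sum.cong refl) (simp add: mult_ac)
  also have "\<dots> = (\<Sum>z\<in>box_at 0 k. \<Sum>y\<in>Y. lap f y * indicator {0} (x + (y + z))) / real k ^ CARD('d) / N"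
    by (subst sum.swap) simp
  also have "\<dots> \<le> (\<Sum>z\<in>box_at 0 k. lap f (x + z)) / real k ^ CARD('d) / N"
    using le N by (intro divide_right_mono sum_mono) auto
  finally show ?thesis .
qed

context
  fixes n :: nat and v :: "int ^ 'd::finite \<Rightarrow> int"
  assumes v: "minimal_supersolution n v"
begin

text \<open>All boxes involved lie in the support of \<open>v\<close>. A box of side
  \<open>k\<close> has \<open>d - d / k\<close> inner edges per site, and subtracting the background
  \<open>d - 1\<close> leaves \<open>1 - d / k\<close>.\<close>

lemma smooth_lap_ge:
  assumes K: "\<And>y. y \<in> Y \<Longrightarrow> K y \<ge> 0" "sum K Y = 1" and k: "k \<ge> 1"
    and pos: "\<And>y z. y \<in> Y \<Longrightarrow> z \<in> box_at 0 k \<Longrightarrow> v (x + (y + z)) > 0"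
  shows "smooth K Y k (\<lambda>x. real_of_int (lap v x)) x \<ge>
    1 - real CARD('d) / real k - real n * smooth K Y k (indicator {0}) x"
proof -
  define d where "d = CARD('d)"
  have d: "d \<ge> 1"
    by (simp add: d_def Suc_leI)
  have kd: "real k ^ d > 0"
    using k by simp
  define I where "I y = (\<Sum>z\<in>box_at 0 k. indicator {0} (x + (y + z))) / real k ^ d" for y
  have step: "1 - real d / real k - real n * I y \<le>
      (\<Sum>z\<in>box_at 0 k. real_of_int (lap v (x + (y + z)))) / real k ^ d" if y: "y \<in> Y" for y
  proof -
    let ?B = "box_at (x + y) k"
    have "?B \<subseteq> {a. v a > 0}"
    proof
      fix a assume "a \<in> ?B"
      then have "a - (x + y) \<in> box_at 0 k"
        by (auto simp: box_at_def algebra_simps)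
      then show "a \<in> {a. v a > 0}"
        using pos[OF y, of "a - (x + y)"] by simp
    qed
    then have "int (edges ?B) \<le> (\<Sum>a\<in>?B. lap v a + int n * indicator {0} a + int d - 1)"
      unfolding d_def by (rule sum_excess_ge_edges[OF v finite_box_at])
    then have "real_of_int (int (edges ?B)) \<le>
        real_of_int (\<Sum>a\<in>?B. lap v a + int n * indicator {0} a + int d - 1)"
      by (rule of_int_le_iff[THEN iffD2])
    also have "\<dots> = (\<Sum>a\<in>?B. real_of_int (lap v a) + real n * indicator {0} a + (real d - 1))"
      unfolding of_int_sum by (intro sum.cong refl) (simp add: indicator_def)
    also have "\<dots> = (\<Sum>a\<in>?B. real_of_int (lap v a)) + real n * (\<Sum>a\<in>?B. indicator {0} a)
        + real k ^ d * (real d - 1)"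
      unfolding sum.distrib by (simp add: card_box_at d_def sum_distrib_left)
    also have "(\<Sum>a\<in>?B. indicator {0} a) = real k ^ d * I y"
      using kd by (simp add: sum_box_at[of _ "x + y"] add.assoc I_def)
    also have "(\<Sum>a\<in>?B. real_of_int (lap v a)) = (\<Sum>z\<in>box_at 0 k. real_of_int (lap v (x + (y + z))))"
      by (simp add: sum_box_at[of _ "x + y"] add.assoc)
    finally have "real (edges ?B) \<le> (\<Sum>z\<in>box_at 0 k. real_of_int (lap v (x + (y + z))))
        + real n * (real k ^ d * I y) + real k ^ d * (real d - 1)"
      by simp
    moreover have "real (edges ?B) = real k ^ d * (real d - real d / real k)"
    proof -
      have "real k ^ d = real k * real k ^ (d - 1)"
        using d by (metis Suc_diff_1 Suc_le_eq One_nat_def power_Suc)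
      then show ?thesis
        using k by (simp add: edges_box_at[OF k] d_def[symmetric] of_nat_diff field_simps)
    qed
    ultimately have "real k ^ d * (1 - real d / real k - real n * I y) \<le>
        (\<Sum>z\<in>box_at 0 k. real_of_int (lap v (x + (y + z))))"
      by (simp add: algebra_simps)
    then show ?thesis
      using kd by (simp add: le_divide_eq mult.commute)
  qed
  have "1 - real d / real k - real n * smooth K Y k (indicator {0}) x =
      (\<Sum>y\<in>Y. K y * (1 - real d / real k - real n * I y))"
  proof -
    have "(\<Sum>y\<in>Y. K y * (a - real n * I y)) = sum K Y * a - real n * (\<Sum>y\<in>Y. K y * I y)" for a
      by (simp add: right_diff_distrib sum_subtractf sum_distrib_left sum_distrib_right mult_ac)
    moreover have "smooth K Y k (indicator {0}) x = (\<Sum>y\<in>Y. K y * I y)"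
      by (simp add: smooth_def I_def d_def)
    ultimately show ?thesis
      using K(2) by simp
  qed
  also have "\<dots> \<le> smooth K Y k (\<lambda>x. real_of_int (lap v x)) x"
    unfolding smooth_def using step K(1) by (intro sum_mono mult_left_mono) (auto simp: d_def)
  finally show ?thesis
    by (simp add: d_def)
qed

text \<open>Maximum principle for \<open>w - g\<close>, with \<open>w\<close> the smoothed odometer
  and \<open>g\<close> the box average of the function in \<open>q\<close>. Where
  \<open>w > B\<close>, no zero of \<open>v\<close> enters the average, so
  \<open>lap w > lap g\<close> and \<open>w - g\<close> has no maximum there; elsewhere
  \<open>w \<le> B\<close> and \<open>g \<ge> q0\<close>.\<close>

lemma comparison:
  assumes f: "\<And>x. lap f x \<ge> 0" "\<And>x. f (- x) = f x"
    and Y: "finite Y" and N: "N = sum (lap f) Y" "N > 0" and k: "k \<ge> 1"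
    and b: "b < 1 - real CARD('d) / real k" and \<mu>: "real n \<le> \<mu> * N"
    and q: "\<And>x. b / (2 * real CARD('d)) * sqnorm x - \<mu> * f x \<ge> q0"
    and B: "B \<ge> 0" "\<And>x y z. y \<in> Y \<Longrightarrow> z \<in> box_at 0 k \<Longrightarrow> v (x + (y + z)) = 0 \<Longrightarrow>
      smooth (\<lambda>y. lap f y / N) Y k (\<lambda>x. real_of_int (v x)) x \<le> B"
  shows "smooth (\<lambda>y. lap f y / N) Y k (\<lambda>x. real_of_int (v x)) x \<le>
    B - q0 + (\<Sum>z\<in>box_at 0 k. b / (2 * real CARD('d)) * sqnorm (x + z) - \<mu> * f (x + z)) / real k ^ CARD('d)"
proof -
  define d where "d = real CARD('d)"
  define c where "c = real k ^ CARD('d)"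
  define K where "K y = lap f y / N" for y
  define w where "w = smooth K Y k (\<lambda>x. real_of_int (v x))"
  define g where "g x = (\<Sum>z\<in>box_at 0 k. b / (2 * d) * sqnorm (x + z) - \<mu> * f (x + z)) / c" for x
  have d: "d > 0" and c: "c > 0"
    using k by (simp_all add: d_def c_def)
  have cardB: "real (card (box_at 0 k :: (int ^ 'd) set)) = c"
    by (simp add: card_box_at c_def)
  have K: "\<And>y. y \<in> Y \<Longrightarrow> K y \<ge> 0" "sum K Y = 1"
    using N f(1) by (auto simp: K_def simp flip: sum_divide_distrib)
  have g_ge: "g x \<ge> q0" for x
  proof -
    have "(\<Sum>z\<in>(box_at 0 k :: (int ^ 'd) set). q0) \<le>
        (\<Sum>z\<in>box_at 0 k. b / (2 * d) * sqnorm (x + z) - \<mu> * f (x + z))"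
      using q unfolding d_def by (intro sum_mono)
    then show ?thesis
      using c by (simp add: g_def cardB le_divide_eq mult.commute)
  qed
  have lap_g: "lap g x = b - \<mu> * ((\<Sum>z\<in>box_at 0 k. lap f (x + z)) / c)" for x
  proof -
    have "g = (\<lambda>x. (1 / c) * (\<Sum>z\<in>box_at 0 k. b / (2 * d) * sqnorm (x + z) - \<mu> * f (x + z)))"
      by (simp add: g_def fun_eq_iff)
    then have "lap g x = (1 / c) * (\<Sum>z\<in>box_at 0 k. b / (2 * d) * lap sqnorm (x + z) - \<mu> * lap f (x + z))"
      by (simp only: lap_mult lap_sum lap_diff lap_shift)
    also have "\<dots> = (1 / c) * (\<Sum>z\<in>box_at 0 k. b - \<mu> * lap f (x + z))"
      using d by (simp add: lap_sqnorm d_def)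
    also have "\<dots> = b - \<mu> * ((\<Sum>z\<in>box_at 0 k. lap f (x + z)) / c)"
      using c by (simp add: sum_subtractf cardB diff_divide_distrib flip: sum_distrib_left)
    finally show ?thesis .
  qed
  have "w x - g x \<le> B - q0"
  proof (rule ccontr)
    define V where "V = {x. w x - g x > B - q0}"
    assume "\<not> w x - g x \<le> B - q0"
    then have "x \<in> V"
      by (simp add: V_def)
    then have ne: "V \<noteq> {}"
      by blast
    have V_sub: "w a > B" if "a \<in> V" for a
      using that g_ge[of a] by (simp add: V_def)
    \<comment> \<open>Away from finitely many translates of the support of \<open>v\<close> the
      average \<open>w\<close> vanishes. Hence \<open>V\<close> is finite and a maximum is
      attained.\<close>
    have "V \<subseteq> (\<Union>y\<in>Y. \<Union>z\<in>box_at 0 k. (\<lambda>a. a - (y + z)) ` {a. v a \<noteq> 0})"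
    proof (rule subsetI, rule ccontr)
      fix a
      assume a: "a \<in> V" "a \<notin> (\<Union>y\<in>Y. \<Union>z\<in>box_at 0 k. (\<lambda>a. a - (y + z)) ` {a. v a \<noteq> 0})"
      have "v (a + (y + z)) = 0" if "y \<in> Y" "z \<in> box_at 0 k" for y z
      proof (rule ccontr)
        assume "v (a + (y + z)) \<noteq> 0"
        then have "a \<in> (\<lambda>a. a - (y + z)) ` {a. v a \<noteq> 0}"
          by (intro image_eqI[of _ _ "a + (y + z)"]) auto
        then show False
          using a(2) that by blast
      qed
      then have "w a = 0"
        by (simp add: w_def smooth_def)
      then show False
        using V_sub[OF a(1)] B(1) by simp
    qed
    then have "finite V"
      by (rule finite_subset) (intro finite_UN_I finite_imageI Y finite_box_at minimal_finite[OF v])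
    then have "Max ((\<lambda>a. w a - g a) ` V) \<in> (\<lambda>a. w a - g a) ` V"
      and Max: "\<And>a. a \<in> V \<Longrightarrow> w a - g a \<le> Max ((\<lambda>a. w a - g a) ` V)"
      using ne by (auto intro!: Max_in)
    then obtain a where a: "a \<in> V" "\<And>a'. a' \<in> V \<Longrightarrow> w a' - g a' \<le> w a - g a"
      by (metis (no_types, lifting) imageE)
    then have max: "w a' - g a' \<le> w a - g a" for a'
      by (cases "a' \<in> V") (force simp: V_def)+
    have "lap (\<lambda>x. w x - g x) a \<le> lap (\<lambda>x. w a - g a) a"
      using max by (intro lap_mono_touching) auto
    then have "lap w a \<le> lap g a"
      by (simp add: lap_const lap_diff)
    moreover have "lap w a > lap g a"
    proof -
      have "v (a + (y + z)) > 0" if "y \<in> Y" "z \<in> box_at 0 k" for y z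
        using B(2)[OF that, of a] V_sub[OF a(1)] minimal_nonneg[OF v, of "a + (y + z)"]
        by (force simp: w_def K_def[abs_def])
      then have "lap w a \<ge> 1 - d / real k - real n * smooth K Y k (indicator {0}) a"
        unfolding w_def lap_smooth lap_of_int d_def by (intro smooth_lap_ge K k)
      moreover have "real n * smooth K Y k (indicator {0}) a \<le>
          real n * ((\<Sum>z\<in>box_at 0 k. lap f (a + z)) / c / N)"
        using smooth_origin_le[OF f N(2) Y, of k a] unfolding K_def[abs_def] c_def
        by (intro mult_left_mono) auto
      moreover have "\<dots> \<le> \<mu> * N * ((\<Sum>z\<in>box_at 0 k. lap f (a + z)) / c / N)"
        using \<mu> c N f(1) by (intro mult_right_mono divide_nonneg_pos sum_nonneg) auto
      moreover have "\<dots> = \<mu> * ((\<Sum>z\<in>box_at 0 k. lap f (a + z)) / c)"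
        using N by simp
      ultimately show ?thesis
        using b lap_g[of a] by (simp add: d_def)
    qed
    ultimately show False
      by simp
  qed
  then show ?thesis
    by (simp add: w_def g_def K_def[abs_def] d_def c_def)
qed

end

text \<open>The radial profile has derivative \<open>c * (1 - (T / S) powr p)\<close> in
  \<open>S\<close>, which changes sign at \<open>S = T\<close>.\<close>

lemma pot_minimum:
  assumes T: "T > 0" and S: "S > 0" and c: "c \<ge> 0" and p: "p \<ge> 0"
  shows "c * S - c * T powr p * pot p S \<ge> c * T - c * T powr p * pot p T"
proof -
  have "T powr p * (pot p S - pot p T) \<le> S - T"
  proof (cases "S \<ge> T")
    case True
    have "T powr p * (pot p S - pot p T) \<le> T powr p * ((S - T) * T powr (- p))"
      using True T p by (intro mult_left_mono pot_diff_bounds) auto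
    also have "\<dots> = S - T"
      using T by (simp add: powr_minus)
    finally show ?thesis .
  next
    case False
    then have "T powr p * (pot p T - pot p S) \<ge> T powr p * ((T - S) * T powr (- p))"
      using S p by (intro mult_left_mono pot_diff_bounds) auto
    then show ?thesis
      using T by (simp add: powr_minus algebra_simps)
  qed
  then have "c * (T powr p * (pot p S - pot p T)) \<le> c * (S - T)"
    using c by (rule mult_left_mono)
  then show ?thesis
    by (simp add: algebra_simps)
qed

lemma pot_quadratic_growth:
  assumes T: "T > 0" and S: "S \<ge> T" and c: "c \<ge> 0" and p: "p = real d / 2"
  shows "(c * S - c * T powr p * pot p S) - (c * T - c * T powr p * pot p T) \<le>
    c * real d * (S - T)\<^sup>2 / S"
proof -
  have S0: "S > 0"
    using T S by simp
  \<comment> \<open>As \<open>T / S \<le> 1\<close>, passing from the exponent \<open>p\<close> to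
    the natural number \<open>d\<close> only lowers the power and makes Bernoulli's inequality
    applicable.\<close>
  have "1 + real d * (T / S - 1) \<le> (1 + (T / S - 1)) ^ d"
    using T S0 by (intro Bernoulli_inequality) auto
  also have "\<dots> = (T / S) powr real d"
    using T S0 by (simp add: powr_realpow)
  also have "\<dots> \<le> (T / S) powr p"
    using T S S0 p by (intro powr_mono') auto
  also have "\<dots> = T powr p * S powr (- p)"
    using T S0 by (simp add: powr_divide powr_minus_divide)
  finally have "(S - T) * (1 - T powr p * S powr (- p)) \<le> (S - T) * (real d * (S - T) / S)"
    using S S0 by (intro mult_left_mono) (auto simp: field_simps)
  moreover have "T powr p * (pot p S - pot p T) \<ge> T powr p * ((S - T) * S powr (- p))"
    using T S p by (intro mult_left_mono pot_diff_bounds) auto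
  ultimately have "(S - T) - T powr p * (pot p S - pot p T) \<le> real d * (S - T)\<^sup>2 / S"
    by (simp add: algebra_simps power2_eq_square)
  then have "c * ((S - T) - T powr p * (pot p S - pot p T)) \<le> c * (real d * (S - T)\<^sup>2 / S)"
    using c by (rule mult_left_mono)
  then show ?thesis
    by (simp add: algebra_simps)
qed

lemma exists_harnack_constant:
  assumes "finite Z"
  shows "\<exists>C\<ge>1. \<forall>n (v :: int ^ 'd::finite \<Rightarrow> int) x z. minimal_supersolution n v \<longrightarrow> z \<in> Z \<longrightarrow>
    real_of_int (v (x + z)) + 1 \<le> C * (real_of_int (v x) + 1)"
proof -
  define h where "h z = (2 * real CARD('d)) ^ nat (\<Sum>i\<in>UNIV. \<bar>z $ i\<bar>)" for z :: "int ^ 'd"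
  define C where "C = Max (insert 1 (h ` Z))"
  have C: "C \<ge> 1" "\<And>z. z \<in> Z \<Longrightarrow> h z \<le> C"
    using assms by (auto simp: C_def)
  have "real_of_int (v (x + z)) + 1 \<le> C * (real_of_int (v x) + 1)"
    if v: "minimal_supersolution n v" and z: "z \<in> Z" for n v x z
  proof -
    have "real_of_int (v (x + z) + 1) \<le>
        real_of_int ((2 * int CARD('d)) ^ nat (\<Sum>i\<in>UNIV. \<bar>z $ i\<bar>) * (v x + 1))"
      using harnack[OF v, of x z] by (rule of_int_le_iff[THEN iffD2])
    then have "real_of_int (v (x + z)) + 1 \<le> h z * (real_of_int (v x) + 1)"
      by (simp add: h_def)
    also have "\<dots> \<le> C * (real_of_int (v x) + 1)"
      using C(2)[OF z] minimal_nonneg[OF v, of x] by (intro mult_right_mono) auto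
    finally show ?thesis .
  qed
  then show ?thesis
    using C(1) by blast
qed

lemma norm_box_le:
  fixes z :: "int ^ 'd::finite"
  assumes "z \<in> box_at 0 k"
  shows "norm (real_vec z) \<le> real k * real CARD('d)"
proof (rule norm_le_card)
  fix i
  have "0 \<le> z $ i" "z $ i < int k"
    using assms by (auto simp: box_at_def)
  then show "\<bar>real_vec z $ i\<bar> \<le> real k"
    by simp
qed

lemma real_vec_add: "real_vec (x + y) = real_vec x + real_vec y"
  by (simp add: vec_eq_iff)

lemma sqnorm_box_bounds:
  fixes x z :: "int ^ 'd::finite"
  assumes "z \<in> box_at 0 k" "h = real k * real CARD('d)" "\<tau> = sqrt (sqnorm x)" "\<tau> \<ge> h"
  shows "(\<tau> - h)\<^sup>2 \<le> sqnorm (x + z)" "sqnorm (x + z) \<le> (\<tau> + h)\<^sup>2"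
proof -
  have \<tau>: "\<tau> = norm (real_vec x)"
    unfolding assms(3) norm_real_vec[symmetric] by simp
  have z: "norm (real_vec z) \<le> h"
    using norm_box_le[OF assms(1)] assms(2) by simp
  have "norm (real_vec x + real_vec z) \<le> \<tau> + h" "\<tau> - h \<le> norm (real_vec x + real_vec z)"
    using norm_triangle_ineq[of "real_vec x" "real_vec z"] norm_diff_ineq[of "real_vec x" "real_vec z"] z \<tau>
    by linarith+
  then show "(\<tau> - h)\<^sup>2 \<le> sqnorm (x + z)" "sqnorm (x + z) \<le> (\<tau> + h)\<^sup>2"
    using assms(4) unfolding norm_real_vec[symmetric] real_vec_add by (auto intro!: power_mono)
qed

text \<open>A point at distance \<open>\<tau>\<close> is tested with the comparison function for a
  source that may be larger than \<open>n\<close>, chosen such that this function has its minimum at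
  distance about \<open>\<tau>\<close>.\<close>

lemma bounded_outside_ball:
  fixes \<delta> :: real
  assumes \<delta>: "\<delta> > 0"
  defines "\<omega> \<equiv> measure lborel (ball (0 :: real ^ 'd::finite) 1)"
  shows "\<exists>\<kappa>\<ge>0. \<exists>M. \<forall>n (v :: int ^ 'd \<Rightarrow> int) x. minimal_supersolution n v \<longrightarrow>
    sqrt (sqnorm x) \<ge> \<kappa> + (1 + \<delta>) * (real n / \<omega>) powr (1 / real CARD('d)) \<longrightarrow> v x \<le> int M"
proof -
  define d where "d = real CARD('d)"
  define p where "p = d / 2"
  \<comment> \<open>The slack \<open>1 + \<delta>\<close> is split into two equal factors: one for
    the flux of the potential, one for the density loss \<open>d / k\<close>.\<close>
  define b where "b = 1 / sqrt (1 + \<delta>)"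
  have d: "d \<ge> 1"
    by (simp add: d_def Suc_leI)
  have p: "p > 0"
    using d by (simp add: p_def)
  have \<omega>: "\<omega> > 0"
    unfolding \<omega>_def by (rule unit_ball_measure_pos)
  have b: "0 < b" "b < 1" "b * b = 1 / (1 + \<delta>)"
    using \<delta> by (auto simp: b_def real_less_rsqrt simp flip: real_sqrt_mult)
  obtain A where A: "A > 0" and sub: "\<And>x :: int ^ 'd. lap (\<lambda>x. pot p (sqnorm x + A)) x \<ge> 0"
    using exists_subharmonic_pot[where 'd = 'd] by (auto simp: p_def d_def)
  define f where "f x = pot p (sqnorm x + A)" for x :: "int ^ 'd"
  have f: "lap f x \<ge> 0" "f (- x) = f x" for x
    using sub[of x] by (simp_all add: f_def[abs_def] sqnorm_def)
  obtain R where R: "(\<Sum>x\<in>(lball R :: (int ^ 'd) set). lap f x) \<ge> b * (2 * d * \<omega>)"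
    using exists_large_flux[OF A b(2), where 'd = 'd] by (auto simp: f_def[abs_def] p_def d_def \<omega>_def)
  define Y where "Y = (lball R :: (int ^ 'd) set)"
  define N where "N = sum (lap f) Y"
  have Y: "finite Y"
    unfolding Y_def by (rule finite_lball)
  have N: "N \<ge> b * (2 * d * \<omega>)"
    using R by (simp add: N_def Y_def)
  then have N0: "N > 0"
    using b \<omega> d by (smt (verit) mult_pos_pos)
  obtain k0 :: nat where k0: "real k0 > d / (1 - b)"
    using reals_Archimedean2 by blast
  define k where "k = Suc k0"
  have k: "k \<ge> 1" "real k > d / (1 - b)"
    using k0 by (simp_all add: k_def)
  have bk: "b < 1 - d / real k"
  proof -
    have "d < (1 - b) * real k"
      using k(2) b(2) by (simp add: divide_less_eq mult.commute)
    then have "d / real k < 1 - b"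
      using k(1) by (simp add: divide_less_eq)
    then show ?thesis
      by simp
  qed
  define h where "h = real k * d"
  have h: "h \<ge> 0"
    using d by (simp add: h_def)
  define W where "W = (\<lambda>(y, z). y + z) ` (Y \<times> box_at 0 k)"
  have "finite (W \<union> uminus ` W)"
    unfolding W_def using Y finite_box_at by auto
  from exists_harnack_constant[OF this] obtain C where C: "C \<ge> 1"
    and harnack: "\<And>n (v :: int ^ 'd \<Rightarrow> int) x z. minimal_supersolution n v \<Longrightarrow> z \<in> W \<union> uminus ` W \<Longrightarrow>
      real_of_int (v (x + z)) + 1 \<le> C * (real_of_int (v x) + 1)"
    by blast
  have W: "y + z \<in> W" if "y \<in> Y" "z \<in> box_at 0 k" for y z
    using that by (auto simp: W_def)
  define K where "K y = lap f y / N" for y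
  have K: "\<And>y. y \<in> Y \<Longrightarrow> K y \<ge> 0" "sum K Y = 1"
    using N0 f(1) by (auto simp: K_def N_def simp flip: sum_divide_distrib)
  define Q where "Q = 2 * (4 * h + A)\<^sup>2"
  define M where "M = nat \<lceil>C * (C * C + Q + 1)\<rceil>"
  have "v x \<le> int M" if v: "minimal_supersolution n v"
    and x: "sqrt (sqnorm x) \<ge> 2 * h + 1 + (1 + \<delta>) * (real n / \<omega>) powr (1 / d)"
    for n and v :: "int ^ 'd \<Rightarrow> int" and x
  proof -
    define \<rho> where "\<rho> = (real n / \<omega>) powr (1 / d)"
    define \<tau> where "\<tau> = sqrt (sqnorm x)"
    \<comment> \<open>The minimum is placed at distance \<open>\<tau> - h\<close> so that every
      point of the box at \<open>x\<close> has squared norm at least \<open>T\<close>, as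
      \<open>pot_quadratic_growth\<close> requires.\<close>
    define T where "T = (\<tau> - h)\<^sup>2"
    define c where "c = b / (2 * d)"
    define \<mu> where "\<mu> = c * T powr p"
    define w where "w = smooth K Y k (\<lambda>x. real_of_int (v x))"
    have \<rho>: "\<rho> \<ge> 0"
      by (simp add: \<rho>_def)
    have \<tau>: "\<tau> \<ge> 2 * h + 1 + (1 + \<delta>) * \<rho>"
      using x by (simp add: \<tau>_def \<rho>_def)
    then have \<tau>2: "\<tau> \<ge> 2 * h + 1"
      using \<rho> \<delta> by (smt (verit) mult_nonneg_nonneg)
    have T: "T > 0"
      using \<tau>2 h by (simp add: T_def)
    have c: "c > 0"
      using b d by (simp add: c_def)
    have Tp: "T powr p = (\<tau> - h) ^ CARD('d)"
    proof -
      have "T powr p = (\<tau> - h) powr d"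
        unfolding T_def p_def using \<tau>2 h by (simp add: powr_powr flip: powr_numeral)
      then show ?thesis
        using \<tau>2 h by (simp add: d_def powr_realpow)
    qed
    have \<rho>d: "\<rho> ^ CARD('d) = real n / \<omega>"
    proof (cases "n = 0")
      case False
      then have "\<rho> ^ CARD('d) = \<rho> powr d"
        using \<omega> by (simp add: \<rho>_def d_def powr_realpow)
      then show ?thesis
        using \<omega> d by (simp add: \<rho>_def powr_powr)
    qed (simp add: \<rho>_def)
    have \<mu>N: "real n \<le> \<mu> * N"
    proof -
      have "real n = \<omega> * \<rho> ^ CARD('d)"
        using \<omega> \<rho>d by simp
      also have "\<dots> \<le> b * b * \<omega> * ((1 + \<delta>) ^ CARD('d) * \<rho> ^ CARD('d))"
      proof -
        have "1 + \<delta> \<le> (1 + \<delta>) ^ CARD('d)"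
          using \<delta> by (intro self_le_power) auto
        then have "1 \<le> b * b * (1 + \<delta>) ^ CARD('d)"
          using \<delta> b(3) by (simp add: le_divide_eq)
        then have "\<omega> * \<rho> ^ CARD('d) * 1 \<le> \<omega> * \<rho> ^ CARD('d) * (b * b * (1 + \<delta>) ^ CARD('d))"
          using \<omega> \<rho> by (intro mult_left_mono) auto
        then show ?thesis
          by (simp add: mult_ac)
      qed
      also have "\<dots> = b * b * \<omega> * ((1 + \<delta>) * \<rho>) ^ CARD('d)"
        by (simp add: power_mult_distrib)
      also have "\<dots> \<le> b * b * \<omega> * T powr p"
        unfolding Tp using \<tau> h b \<omega> \<rho> \<delta> by (intro mult_left_mono power_mono) auto
      also have "\<dots> = \<mu> * (b * (2 * d * \<omega>))"
        using d by (simp add: \<mu>_def c_def)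
      also have "\<dots> \<le> \<mu> * N"
        using N c by (intro mult_left_mono) (auto simp: \<mu>_def)
      finally show ?thesis .
    qed
    define q where "q S = c * S - \<mu> * pot p S" for S
    have q_eq: "q (sqnorm a + A) = b / (2 * real CARD('d)) * sqnorm a - \<mu> * f a + c * A" for a
      unfolding q_def f_def d_def[symmetric] c_def[symmetric] by (simp add: distrib_left)
    have q_min: "q (sqnorm a + A) \<ge> q T" for a :: "int ^ 'd"
      unfolding q_def \<mu>_def using T A c p sqnorm_nonneg[of a] by (intro pot_minimum) auto
    \<comment> \<open>\<open>S - T\<close> grows linearly in \<open>\<tau>\<close> but
      \<open>T\<close> quadratically, so \<open>(S - T)\<^sup>2 / S\<close> is bounded by a constant
      independent of \<open>n\<close> and \<open>x\<close>.\<close>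
    have q_max: "q (sqnorm (x + z) + A) - q T \<le> Q" if z: "z \<in> box_at 0 k" for z
    proof -
      define S where "S = sqnorm (x + z) + A"
      have "(\<tau> - h)\<^sup>2 \<le> sqnorm (x + z)" "sqnorm (x + z) \<le> (\<tau> + h)\<^sup>2"
        using sqnorm_box_bounds[OF z h_def[unfolded d_def] \<tau>_def] \<tau>2 h by auto
      then have S: "S \<ge> T" "S - T \<le> 4 * h * \<tau> + A"
        using A by (simp_all add: S_def T_def power2_sum power2_diff)
      have "q S - q T \<le> c * d * (S - T)\<^sup>2 / S"
        unfolding q_def \<mu>_def d_def using T S(1) c
        by (intro pot_quadratic_growth) (auto simp: p_def d_def)
      also have "\<dots> \<le> c * d * (S - T)\<^sup>2 / T"
        using T S c d by (intro divide_left_mono) auto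
      also have "\<dots> \<le> c * d * ((4 * h + A) * \<tau>)\<^sup>2 / T"
      proof -
        have "A * 1 \<le> A * \<tau>"
          using A \<tau>2 h by (intro mult_left_mono) auto
        then have "S - T \<le> (4 * h + A) * \<tau>"
          using S(2) by (simp add: algebra_simps)
        then show ?thesis
          using T S(1) c d by (intro divide_right_mono mult_left_mono power_mono) auto
      qed
      also have "\<dots> \<le> c * d * ((4 * h + A) * \<tau>)\<^sup>2 / (\<tau>\<^sup>2 / 4)"
      proof -
        have "(\<tau> / 2)\<^sup>2 \<le> T"
          unfolding T_def using \<tau>2 h by (intro power_mono) auto
        then show ?thesis
          using T c d \<tau>2 h by (intro divide_left_mono) (auto simp: power_divide)
      qed
      also have "\<dots> = b * Q"
        using d \<tau>2 h by (simp add: c_def Q_def power_mult_distrib)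
      also have "\<dots> \<le> Q"
        using b by (intro mult_left_le_one_le) (auto simp: Q_def)
      finally show ?thesis
        by (simp add: S_def)
    qed
    have v0: "real_of_int (v a) \<ge> 0" for a
      using minimal_nonneg[OF v, of a] by simp
    \<comment> \<open>Two applications of Harnack: from the zero of \<open>v\<close> back to
      \<open>a\<close>, then from \<open>a\<close> to every site in the average.\<close>
    have bound: "w a \<le> C * C" if yz: "y \<in> Y" "z \<in> box_at 0 k" and zero: "v (a + (y + z)) = 0" for a y z
    proof -
      have "- (y + z) \<in> W \<union> uminus ` W"
        using W[OF yz] by blast
      from harnack[OF v this, of "a + (y + z)"] have va: "real_of_int (v a) + 1 \<le> C"
        using zero by simp
      have "real_of_int (v (a + (y' + z'))) \<le> C * C" if "y' \<in> Y" "z' \<in> box_at 0 k" for y' z'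
      proof -
        have "real_of_int (v (a + (y' + z'))) + 1 \<le> C * (real_of_int (v a) + 1)"
          using W[OF that] by (intro harnack[OF v]) auto
        also have "\<dots> \<le> C * C"
          using va C by (intro mult_left_mono) auto
        finally show ?thesis
          by simp
      qed
      then have "w a \<le> smooth K Y k (\<lambda>_. C * C) a"
        unfolding w_def using K(1) by (intro smooth_mono)
      then show ?thesis
        using smooth_const[OF K(2) k(1)] by simp
    qed
    have "w x \<le> C * C - (q T - c * A) +
      (\<Sum>z\<in>box_at 0 k. b / (2 * real CARD('d)) * sqnorm (x + z) - \<mu> * f (x + z)) / real k ^ CARD('d)"
      unfolding w_def K_def
    proof (rule comparison[OF v f Y N_def N0 k(1) _ \<mu>N])
      show "b < 1 - real CARD('d) / real k"
        using bk by (simp add: d_def)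
      show "q T - c * A \<le> b / (2 * real CARD('d)) * sqnorm a - \<mu> * f a" for a
        using q_min[of a] unfolding q_eq by linarith
      show "0 \<le> C * C"
        by simp
      show "smooth (\<lambda>y. lap f y / N) Y k (\<lambda>x. real_of_int (v x)) a \<le> C * C"
        if "y \<in> Y" "z \<in> box_at 0 k" "v (a + (y + z)) = 0" for a y z
        using bound[OF that] by (simp add: w_def K_def[abs_def])
    qed
    also have "\<dots> \<le> C * C - (q T - c * A) + (Q + q T - c * A)"
    proof -
      have "(\<Sum>z\<in>box_at 0 k. b / (2 * real CARD('d)) * sqnorm (x + z) - \<mu> * f (x + z)) \<le>
          (\<Sum>z\<in>(box_at 0 k :: (int ^ 'd) set). Q + q T - c * A)"
      proof (rule sum_mono)
        fix z :: "int ^ 'd"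
        assume "z \<in> box_at 0 k"
        from q_max[OF this] show "b / (2 * real CARD('d)) * sqnorm (x + z) - \<mu> * f (x + z) \<le> Q + q T - c * A"
          unfolding q_eq by linarith
      qed
      then have "(\<Sum>z\<in>box_at 0 k. b / (2 * real CARD('d)) * sqnorm (x + z) - \<mu> * f (x + z)) /
          real k ^ CARD('d) \<le> Q + q T - c * A"
        using k(1) by (subst pos_divide_le_eq) (simp_all add: card_box_at mult.commute)
      then show ?thesis
        by simp
    qed
    finally have w: "w x \<le> C * C + Q"
      by simp
    \<comment> \<open>Harnack in the reverse direction, averaged with the smoothing weights,
      recovers a pointwise bound from the bound on \<open>w x\<close>.\<close>
    have "real_of_int (v x) + 1 \<le> C * (w x + 1)"
    proof -
      have "real_of_int (v x) + 1 \<le> C * real_of_int (v (x + (y + z))) + C"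
        if "y \<in> Y" "z \<in> box_at 0 k" for y z
      proof -
        have "- (y + z) \<in> W \<union> uminus ` W"
          using W[OF that] by blast
        from harnack[OF v this, of "x + (y + z)"] show ?thesis
          by (simp add: algebra_simps)
      qed
      then have "smooth K Y k (\<lambda>_. real_of_int (v x) + 1) x \<le> smooth K Y k (\<lambda>a. C * real_of_int (v a) + C) x"
        using K(1) by (intro smooth_mono)
      then show ?thesis
        unfolding smooth_const[OF K(2) k(1)] smooth_affine[OF K(2) k(1)] w_def by (simp add: algebra_simps)
    qed
    also have "\<dots> \<le> C * (C * C + Q + 1)"
      using w C by (intro mult_left_mono) auto
    finally show ?thesis
      unfolding M_def by linarith
  qed
  then show ?thesis
    using h by (intro exI[of _ "2 * h + 1"] conjI exI[of _ M]) (auto simp: d_def)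
qed

section \<open>The toppled sites on the background\<close>

lemma stable_background: "stable (background m)"
  by (simp add: stable_def background_def indicator_def)

theorem theorem1p2:
  fixes e :: "nat \<Rightarrow> int ^ 'd" and m :: nat
  assumes "bij e" and "m \<ge> 1"
  shows "robust e (background m) \<and>
    (\<forall>\<epsilon>>0. \<forall>\<^sub>F n in sequentially.
       toppled_sites e (background m) n \<subseteq>
         cube (real m * (real CARD('d) + \<epsilon>) *
           (real n / measure lborel (ball (0 :: real ^ 'd) 1)) powr (1 / real CARD('d))))"
proof (intro conjI allI impI)
  have "finite (toppled_sites e (background m) n)" for n
  proof -
    obtain v :: "int ^ 'd \<Rightarrow> int" where v: "minimal_supersolution n v"
      using exists_minimal_supersolution by blast
    define R where "R = Max (insert 0 (linf ` {x. v x \<noteq> 0}))"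
    have "v x = 0" if "linf x > R" for x
    proof (rule ccontr)
      assume "v x \<noteq> 0"
      then have "linf x \<le> R"
        unfolding R_def using minimal_finite[OF v] by (intro Max_ge) auto
      then show False
        using that by simp
    qed
    then have "toppled_sites e (background m) n \<subseteq> {x. linf x \<le> m * CARD('d) * (R + 2)}"
      by (intro toppled_sites_background_subset[OF assms minimal_nonneg[OF v] minimal_lap[OF v]])
    then show ?thesis
      by (rule finite_subset) (rule finite_linf_le)
  qed
  then show "robust e (background m)"
    by (simp add: robust_def stable_background)
next
  fix \<epsilon> :: real assume \<epsilon>: "\<epsilon> > 0"
  define d where "d = real CARD('d)"
  define \<omega> where "\<omega> = measure lborel (ball (0 :: real ^ 'd) 1)"
  \<comment> \<open>Then \<open>d * (1 + \<delta>) = d + \<epsilon> / 2\<close>; the other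
    \<open>\<epsilon> / 2\<close> absorbs the additive constants once \<open>\<rho> n\<close> is
    large.\<close>
  define \<delta> where "\<delta> = \<epsilon> / (2 * d)"
  define \<rho> where "\<rho> n = (real n / \<omega>) powr (1 / d)" for n
  have d: "d > 0"
    by (simp add: d_def)
  have \<omega>: "\<omega> > 0"
    unfolding \<omega>_def by (rule unit_ball_measure_pos)
  have \<delta>: "\<delta> > 0"
    using \<epsilon> d by (simp add: \<delta>_def)
  obtain \<kappa> M where \<kappa>: "\<kappa> \<ge> 0" and bound: "\<And>n (v :: int ^ 'd \<Rightarrow> int) x. minimal_supersolution n v \<Longrightarrow>
      sqrt (sqnorm x) \<ge> \<kappa> + (1 + \<delta>) * \<rho> n \<Longrightarrow> v x \<le> int M"
    using bounded_outside_ball[OF \<delta>, where 'd = 'd] unfolding \<rho>_def \<omega>_def d_def by blast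
  have "filterlim \<rho> at_top sequentially"
    unfolding \<rho>_def using \<omega> d by real_asymp
  then have "eventually (\<lambda>n. \<rho> n \<ge> d * (\<kappa> + real M + 3) / (\<epsilon> / 2)) sequentially"
    by (simp add: filterlim_at_top)
  then show "\<forall>\<^sub>F n in sequentially. toppled_sites e (background m) n \<subseteq>
      cube (real m * (real CARD('d) + \<epsilon>) *
        (real n / measure lborel (ball (0 :: real ^ 'd) 1)) powr (1 / real CARD('d)))"
  proof eventually_elim
    case (elim n)
    obtain v :: "int ^ 'd \<Rightarrow> int" where v: "minimal_supersolution n v"
      using exists_minimal_supersolution by blast
    define t where "t = \<lceil>\<kappa> + (1 + \<delta>) * \<rho> n\<rceil>"
    define R where "R = nat t + M"
    have t0: "\<kappa> + (1 + \<delta>) * \<rho> n \<ge> 0"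
      using \<kappa> \<delta> by (intro add_nonneg_nonneg mult_nonneg_nonneg) (auto simp: \<rho>_def)
    then have t: "t \<ge> 0"
      by (simp add: t_def)
    have "v x = 0" if "linf x > R" for x
    proof -
      obtain i where i: "\<bar>x $ i\<bar> = int (linf x)"
        by (rule linf_attained)
      define s :: int where "s = sgn (x $ i)"
      have s: "\<bar>s\<bar> = 1"
        using i that by (auto simp: s_def)
      \<comment> \<open>The half-space is taken along a coordinate where \<open>x\<close> attains
        its sup norm; it lies outside the ball because a coordinate never exceeds the Euclidean
        norm.\<close>
      have "v y \<le> int M" if y: "s * y $ i \<ge> t" for y
      proof (rule bound[OF v])
        have "\<bar>y $ i\<bar> \<ge> t"
          using y s by (metis abs_ge_self abs_mult mult_1 order_trans)
        then have "\<kappa> + (1 + \<delta>) * \<rho> n \<le> \<bar>real_of_int (y $ i)\<bar>"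
          unfolding t_def by linarith
        also have "\<dots> \<le> sqrt (sqnorm y)"
          using real_sqrt_le_mono[OF coord_sq_le_sqnorm[of y i]] by simp
        finally show "\<kappa> + (1 + \<delta>) * \<rho> n \<le> sqrt (sqnorm y)" .
      qed
      moreover have "s * x $ i > t + int M"
        using i that t by (simp add: s_def R_def sgn_mult_abs abs_sgn mult.commute[of "sgn _"] flip: abs_sgn)
      ultimately show ?thesis
        using linear_growth[OF v s t] by blast
    qed
    then have sub: "toppled_sites e (background m) n \<subseteq> {x. linf x \<le> m * CARD('d) * (R + 2)}"
      by (intro toppled_sites_background_subset[OF assms minimal_nonneg[OF v] minimal_lap[OF v]])
    have "real (m * CARD('d) * (R + 2)) \<le> real m * ((d + \<epsilon>) * \<rho> n)"
    proof -
      have "real R \<le> \<kappa> + (1 + \<delta>) * \<rho> n + 1 + real M"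
        using t by (simp add: R_def t_def)
      then have "d * (real R + 2) \<le> d * (\<kappa> + real M + 3 + (1 + \<delta>) * \<rho> n)"
        using d by (intro mult_left_mono) auto
      also have "\<dots> = d * (\<kappa> + real M + 3) + (d + \<epsilon> / 2) * \<rho> n"
        using d by (simp add: \<delta>_def field_simps)
      also have "\<dots> \<le> \<epsilon> / 2 * \<rho> n + (d + \<epsilon> / 2) * \<rho> n"
        using elim \<epsilon> by (simp add: divide_le_eq mult.commute)
      also have "\<dots> = (d + \<epsilon>) * \<rho> n"
        by (simp add: algebra_simps)
      finally have "real m * (d * (real R + 2)) \<le> real m * ((d + \<epsilon>) * \<rho> n)"
        by (intro mult_left_mono) auto
      moreover have "real (m * CARD('d) * (R + 2)) = real m * (d * (real R + 2))"
        by (simp add: d_def algebra_simps)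
      ultimately show ?thesis
        by simp
    qed
    then have "{x :: int ^ 'd. linf x \<le> m * CARD('d) * (R + 2)} \<subseteq> cube (real m * ((d + \<epsilon>) * \<rho> n))"
      using order_trans[OF of_nat_mono] by (auto simp only: mem_cube_iff mem_Collect_eq)
    with sub have "toppled_sites e (background m) n \<subseteq> cube (real m * ((d + \<epsilon>) * \<rho> n))"
      by (rule subset_trans)
    then show ?case
      by (simp only: \<rho>_def d_def \<omega>_def mult.assoc)
  qed
qed

end
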